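(* Let $A\in\mathbb{C}^{n\times n}$ with $f(A)$ well defined, and assume that $m\ge 1$ iterations of the inexact Lanczos bidiagonalization have been carried out (without breakdown), with the resulting quantities $U_m,V_m,v_{m+1},M_m,T_m,t_{k+1,k},g_k^{(1)},g_k^{(2)},\mathcal{F},\mathcal{W}_{2m},\widetilde{\mathcal{B}}_{2k}$ as described in the context. Let $(\theta,q)$ be an eigenpair of $\widetilde{\mathcal{B}}_{2m}$, where $\theta$ is a simple eigenvalue and $\|q\|=1$, and let $r_{2m}=t_{m+1,m}\begin{bmatrix}0\\ v_{m+1}\end{bmatrix}e_m^*q$ with $e_m\in\mathbb{R}^{2m}$. Let $\varepsilon_{out}>0$ be real. For $1<k\le m$, call an eigenpair $(\theta^{2(k-1)},q^{2(k-1)})$ of $\widetilde{\mathcal{B}}_{2(k-1)}$ with $\|q^{2(k-1)}\|=1$ admissible if, with the associated quantities $r_{2(k-1)}$, $s_{2m}$, $\delta_{2m,2(k-1)}$ defined in the context, $\delta_{2m,2(k-1)}>0$ and $$\|r_{2(k-1)}\|<\frac{\delta_{2m,2(k-1)}^2}{4\|s_{2m}\|},$$ and, for every eigenvalue $\theta_j$ of $\widetilde{\mathcal{B}}_{2m}$ with $\theta_j\ne\theta$, $$|\theta_j-\theta^{2(k-1)}|>2\,\frac{\|s_{2m}\|\,\|r_{2(k-1)}\|}{\delta_{2m,2(k-1)}}.$$ Assume that for every $k=1,\dots,m$: if $k>1$ and an admissible eigenpair of $\widetilde{\mathcal{B}}_{2(k-1)}$ exists, then, for such an eigenpair, $$\|g_k^{(1)}\|,\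 \|g_k^{(2)}\|\ \le\ \frac{\delta_{2m,2(k-1)}}{2m\,\|r_{2(k-1)}\|}\,\varepsilon_{out};$$ otherwise, $$\|g_k^{(1)}\|,\ \|g_k^{(2)}\|\ \le\ \frac1m\,\varepsilon_{out}.$$ Then $$\|(\mathcal{F}\mathcal{W}_{2m}q-\theta\,\mathcal{W}_{2m}q)-r_{2m}\|\le\varepsilon_{out}.$$
   Context: $\|\cdot\|$ is the Euclidean vector norm, $^*$ the conjugate transpose, $e_j$ the $j$-th column of the identity matrix of appropriate size, $\sigma_{\min}$ the smallest singular value. Inexact Lanczos bidiagonalization. After $m$ iterations one has matrices $U_m=[u_1,\dots,u_m]\in\mathbb{C}^{n\times m}$ and $[V_m,v_{m+1}]=[v_1,\dots,v_{m+1}]\in\mathbb{C}^{n\times(m+1)}$, each with orthonormal columns, an upper triangular matrix $M_m\in\mathbb{C}^{m\times m}$, an upper Hessenberg matrix $T_m\in\mathbb{C}^{m\times m}$ and a scalar $t_{m+1,m}$ such that $$f(A)V_m+G_m^{(1)}=U_mM_m,\qquad f(A)^*U_m+G_m^{(2)}=V_mT_m+t_{m+1,m}v_{m+1}e_m^*,$$ where $G_m^{(i)}=[g_1^{(i)},\dots,g_m^{(i)}]\in\mathbb{C}^{n\times m}$, $i=1,2$; the vectors $g_k^{(1)}$, $g_k^{(2)}$ are the errors made in the approximate computation of $f(A)v_k$ and $f(A)^*u_k$, respectively. For $k<m$, $t_{k+1,k}$ denotes the $(k+1,k)$ entry of $T_m$. "Without breakdown" means that all diagonal entries of $M_m$ and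 all $t_{k+1,k}$, $k=1,\dots,m$, are nonzero. Define $$\mathcal{F}=\begin{bmatrix} 0 & f(A) \\ f(A)^* & 0 \end{bmatrix},\qquad \mathcal{W}_{2m}=\begin{bmatrix} U_m & 0 \\ 0 & V_m \end{bmatrix},\qquad \widetilde{\mathcal{B}}_{2k}=\begin{bmatrix} 0 & M_k \\ T_k & 0 \end{bmatrix}\in\mathbb{C}^{2k\times 2k}\quad(1\le k\le m),$$ where $M_k,T_k$ are the leading $k\times k$ submatrices of $M_m,T_m$. Quantities associated with an eigenpair. Let $1\le \ell\le m$ and let $(\theta^{(2\ell)},q^{(2\ell)})$ be an eigenpair of $\widetilde{\mathcal{B}}_{2\ell}$ with $q^{(2\ell)}=[x;y]$ of unit norm, $x,y\in\mathbb{C}^\ell$ (in the claim $\ell=k-1$, and the pair is written $(\theta^{2(k-1)},q^{2(k-1)})$). Set $\widetilde q=[x;0;y;0]\in\mathbb{C}^{2m}$, with zero vectors of length $m-\ell$. Choose $Y\in\mathbb{C}^{2m\times(2m-1)}$ such that $[\widetilde q,Y]$ is unitary and put $\underline{\widetilde{\mathcal{B}}}_{2m}=Y^*\widetilde{\mathcal{B}}_{2m}Y$. Define $$s_{2m}^*=\widetilde q^*\widetilde{\mathcal{B}}_{2m}-\theta^{(2\ell)}\widetilde q^*,\qquad \delta_{2m,2\ell}=\sigma_{\min}(\underline{\widetilde{\mathcal{B}}}_{2m}-\theta^{(2\ell)}I),\qquad r_{2\ell}=t_{\ell+1,\ell}\begin{bmatrix}0\\ v_{\ell+1}\end{bmatrix}e_\ell^*q^{(2\ell)},\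 e_\ell\in\mathbb{R}^{2\ell}.$$ ($\delta_{2m,2\ell}$ does not depend on the choice of $Y$.) If $s_{2m}=0$, a quotient with $\|s_{2m}\|$ in the denominator is read as $+\infty$. *)

theory Defs
  imports
    "HOL-Analysis.Derivative"
    "HOL-Analysis.L2_Norm"
    "HOL-Library.Extended_Real"
    "Jordan_Normal_Form.Jordan_Normal_Form_Existence"
begin

no_notation inner (infix "\<bullet>" 70)

text \<open>
  Primary matrix functions via the Jordan canonical form. The function \<open>f\<close> has to possess, at each
  eigenvalue \<open>a\<close>, derivatives up to order one less than the size of the largest Jordan block of
  \<open>a\<close>. Since \<open>deriv\<close> is total, existence of the \<open>j\<close>-th derivative at \<open>a\<close> is spelled out: the lower
  order derivatives below \<open>j - 1\<close> must be differentiable around \<open>a\<close>, and the \<open>(j - 1)\<close>-st one at \<open>a\<close>.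
\<close>

definition times_differentiable :: "nat \<Rightarrow> (complex \<Rightarrow> complex) \<Rightarrow> complex \<Rightarrow> bool" where
  "times_differentiable j f a \<longleftrightarrow>
     (\<forall>i<j. (deriv ^^ i) f field_differentiable at a) \<and>
     (\<forall>i. i + 1 < j \<longrightarrow> (\<forall>\<^sub>F w in nhds a. (deriv ^^ i) f field_differentiable at w))"

definition defined_on_spectrum :: "(complex \<Rightarrow> complex) \<Rightarrow> complex mat \<Rightarrow> bool" where
  "defined_on_spectrum f A \<longleftrightarrow>
     (\<forall>n_as. jordan_nf A n_as \<longrightarrow> (\<forall>(k, a) \<in> set n_as. times_differentiable (k - 1) f a))"

definition fun_jordan_block :: "(complex \<Rightarrow> complex) \<Rightarrow> nat \<Rightarrow> complex \<Rightarrow> complex mat" where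
  "fun_jordan_block f k a =
     mat k k (\<lambda>(i, j). if i \<le> j then (deriv ^^ (j - i)) f a / fact (j - i) else 0)"

text \<open>The value does not depend on the Jordan decomposition \<open>A = P J Q\<close>, \<open>Q = P\<^sup>-\<^sup>1\<close>, that is chosen.\<close>

definition mat_fun :: "(complex \<Rightarrow> complex) \<Rightarrow> complex mat \<Rightarrow> complex mat" where
  "mat_fun f A =
     (SOME B. \<exists>n_as P Q. 0 \<notin> fst ` set n_as \<and> similar_mat_wit A (jordan_matrix n_as) P Q \<and>
        B = P * diag_block_mat (map (\<lambda>(k, a). fun_jordan_block f k a) n_as) * Q)"

definition vnorm :: "complex vec \<Rightarrow> real" where
  "vnorm w = L2_set (\<lambda>i. cmod (w $ i)) {..<dim_vec w}"

definition orthonormal_cols :: "complex mat \<Rightarrow> bool" where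
  "orthonormal_cols Q \<longleftrightarrow> mat_adjoint Q * Q = 1\<^sub>m (dim_col Q)"

definition unitary_mat :: "complex mat \<Rightarrow> bool" where
  "unitary_mat Q \<longleftrightarrow>
     square_mat Q \<and> inverts_mat (mat_adjoint Q) Q \<and> inverts_mat Q (mat_adjoint Q)"

definition upper_hessenberg :: "complex mat \<Rightarrow> bool" where
  "upper_hessenberg H \<longleftrightarrow> (\<forall>i<dim_row H. \<forall>j<dim_col H. j + 1 < i \<longrightarrow> H $$ (i, j) = 0)"

definition singular_values :: "complex mat \<Rightarrow> real set" where
  "singular_values C = {sqrt (Re \<mu>) | \<mu>. eigenvalue (mat_adjoint C * C) \<mu>}"

definition sigma_min :: "complex mat \<Rightarrow> real" where
  "sigma_min C = Min (singular_values C)"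

definition simple_eigenvalue :: "complex mat \<Rightarrow> complex \<Rightarrow> bool" where
  "simple_eigenvalue B \<theta> \<longleftrightarrow> order \<theta> (char_poly B) = 1"

text \<open>
  Sequences of vectors and matrix entries are indexed from 1, as in \<open>u\<^sub>1, \<dots>, u\<^sub>m\<close>; a matrix such
  as \<open>T\<^sub>m\<close> is given by its entries \<open>t i j\<close>, so that \<open>lead_mat t k\<close> is its leading \<open>k \<times> k\<close> submatrix and
  the extra scalar \<open>t\<^sub>m\<^sub>+\<^sub>1\<^sub>,\<^sub>m\<close> is \<open>t (m + 1) m\<close>. Indices into \<open>vec\<close> and \<open>mat\<close> objects start at 0.
\<close>

definition seq_mat :: "nat \<Rightarrow> (nat \<Rightarrow> complex vec) \<Rightarrow> nat \<Rightarrow> complex mat" where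
  "seq_mat n u k = mat_of_cols n (map u [1..<k + 1])"

definition lead_mat :: "(nat \<Rightarrow> nat \<Rightarrow> complex) \<Rightarrow> nat \<Rightarrow> complex mat" where
  "lead_mat t k = mat k k (\<lambda>(i, j). t (i + 1) (j + 1))"

definition inexact_lanczos ::
  "nat \<Rightarrow> nat \<Rightarrow> complex mat \<Rightarrow> (nat \<Rightarrow> complex vec) \<Rightarrow> (nat \<Rightarrow> complex vec) \<Rightarrow>
   (nat \<Rightarrow> nat \<Rightarrow> complex) \<Rightarrow> (nat \<Rightarrow> nat \<Rightarrow> complex) \<Rightarrow>
   (nat \<Rightarrow> complex vec) \<Rightarrow> (nat \<Rightarrow> complex vec) \<Rightarrow> bool" where
  "inexact_lanczos n m fA u v \<mu> t g1 g2 \<longleftrightarrow>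
     (\<forall>k\<in>{1..m}. u k \<in> carrier_vec n \<and> g1 k \<in> carrier_vec n \<and> g2 k \<in> carrier_vec n) \<and>
     (\<forall>k\<in>{1..m + 1}. v k \<in> carrier_vec n) \<and>
     orthonormal_cols (seq_mat n u m) \<and>
     orthonormal_cols (seq_mat n v (m + 1)) \<and>
     upper_triangular (lead_mat \<mu> m) \<and>
     upper_hessenberg (lead_mat t m) \<and>
     fA * seq_mat n v m + seq_mat n g1 m = seq_mat n u m * lead_mat \<mu> m \<and>
     mat_adjoint fA * seq_mat n u m + seq_mat n g2 m =
       seq_mat n v m * lead_mat t m +
       t (m + 1) m \<cdot>\<^sub>m (mat_of_cols n [v (m + 1)] * mat_of_rows m [unit_vec m (m - 1)])"

definition no_breakdown :: "nat \<Rightarrow> (nat \<Rightarrow> nat \<Rightarrow> complex) \<Rightarrow> (nat \<Rightarrow> nat \<Rightarrow> complex) \<Rightarrow> bool" where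
  "no_breakdown m \<mu> t \<longleftrightarrow> (\<forall>k\<in>{1..m}. \<mu> k k \<noteq> 0 \<and> t (k + 1) k \<noteq> 0)"

definition F_mat :: "nat \<Rightarrow> complex mat \<Rightarrow> complex mat" where
  "F_mat n fA = four_block_mat (0\<^sub>m n n) fA (mat_adjoint fA) (0\<^sub>m n n)"

definition W_mat :: "nat \<Rightarrow> (nat \<Rightarrow> complex vec) \<Rightarrow> (nat \<Rightarrow> complex vec) \<Rightarrow> nat \<Rightarrow> complex mat" where
  "W_mat n u v m = four_block_mat (seq_mat n u m) (0\<^sub>m n m) (0\<^sub>m n m) (seq_mat n v m)"

definition B_mat :: "(nat \<Rightarrow> nat \<Rightarrow> complex) \<Rightarrow> (nat \<Rightarrow> nat \<Rightarrow> complex) \<Rightarrow> nat \<Rightarrow> complex mat" where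
  "B_mat \<mu> t k = four_block_mat (0\<^sub>m k k) (lead_mat \<mu> k) (lead_mat t k) (0\<^sub>m k k)"

definition r_vec ::
  "nat \<Rightarrow> (nat \<Rightarrow> complex vec) \<Rightarrow> (nat \<Rightarrow> nat \<Rightarrow> complex) \<Rightarrow> nat \<Rightarrow> complex vec \<Rightarrow> complex vec" where
  "r_vec n v t l q =
     (t (l + 1) l * (unit_vec (2 * l) (l - 1) \<bullet> q)) \<cdot>\<^sub>v (0\<^sub>v n @\<^sub>v v (l + 1))"

definition q_tilde :: "nat \<Rightarrow> nat \<Rightarrow> complex vec \<Rightarrow> complex vec" where
  "q_tilde m l q =
     vec_first q l @\<^sub>v 0\<^sub>v (m - l) @\<^sub>v vec_last q l @\<^sub>v 0\<^sub>v (m - l)"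

text \<open>The column vector \<open>s\<close> with \<open>s\<^sup>* = q\<^sup>* B - \<theta> q\<^sup>*\<close>.\<close>

definition s_vec :: "complex mat \<Rightarrow> complex \<Rightarrow> complex vec \<Rightarrow> complex vec" where
  "s_vec B \<theta> q = mat_adjoint B *\<^sub>v q - cnj \<theta> \<cdot>\<^sub>v q"

text \<open>
  The choice of \<open>Y\<close> is immaterial for \<open>delta\<close>: two completions of a unit vector differ by a unitary
  factor on the right, which leaves the singular values below unchanged.
\<close>

definition unitary_completion :: "complex vec \<Rightarrow> complex mat" where
  "unitary_completion q =
     (SOME Y. Y \<in> carrier_mat (dim_vec q) (dim_vec q - 1) \<and>
        unitary_mat (mat_of_cols (dim_vec q) (q # cols Y)))"

definition delta :: "complex mat \<Rightarrow> complex \<Rightarrow> complex vec \<Rightarrow> real" where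
  "delta B \<theta> q =
     (let Y = unitary_completion q
      in sigma_min (mat_adjoint Y * B * Y - \<theta> \<cdot>\<^sub>m 1\<^sub>m (dim_col Y)))"

text \<open>
  Quotients are taken in the extended reals, where a positive number divided by 0 is \<open>\<infinity>\<close>.
  Here \<open>\<theta>\<close> is the eigenvalue of \<open>B_mat \<mu> t m\<close> of interest and \<open>(\<eta>, p)\<close> a unit eigenpair of
  \<open>B_mat \<mu> t l\<close>, where \<open>l = k - 1\<close>.
\<close>

definition admissible ::
  "nat \<Rightarrow> nat \<Rightarrow> (nat \<Rightarrow> complex vec) \<Rightarrow> (nat \<Rightarrow> nat \<Rightarrow> complex) \<Rightarrow> (nat \<Rightarrow> nat \<Rightarrow> complex) \<Rightarrow>
   complex \<Rightarrow> nat \<Rightarrow> complex \<Rightarrow> complex vec \<Rightarrow> bool" where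
  "admissible n m v \<mu> t \<theta> l \<eta> p \<longleftrightarrow>
     eigenvector (B_mat \<mu> t l) p \<eta> \<and> vnorm p = 1 \<and>
     (let B = B_mat \<mu> t m;
          r = vnorm (r_vec n v t l p);
          s = vnorm (s_vec B \<eta> (q_tilde m l p));
          \<delta> = delta B \<eta> (q_tilde m l p)
      in \<delta> > 0 \<and>
         ereal r < ereal (\<delta>\<^sup>2) / ereal (4 * s) \<and>
         (\<forall>\<theta>'. eigenvalue B \<theta>' \<and> \<theta>' \<noteq> \<theta> \<longrightarrow> cmod (\<theta>' - \<eta>) > 2 * (s * r / \<delta>)))"

definition relaxed_bound ::
  "nat \<Rightarrow> nat \<Rightarrow> (nat \<Rightarrow> complex vec) \<Rightarrow> (nat \<Rightarrow> nat \<Rightarrow> complex) \<Rightarrow> (nat \<Rightarrow> nat \<Rightarrow> complex) \<Rightarrow>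
   nat \<Rightarrow> complex \<Rightarrow> complex vec \<Rightarrow> ereal" where
  "relaxed_bound n m v \<mu> t l \<eta> p =
     ereal (delta (B_mat \<mu> t m) \<eta> (q_tilde m l p)) /
     ereal (2 * real m * vnorm (r_vec n v t l p))"

end

theory Submission
  imports Defs "Jordan_Normal_Form.Spectral_Radius"
begin

text \<open>
  Writing \<open>q = [x; y]\<close>, the Lanczos relations give the gap between the true and the computed residual
  as \<open>- [G\<^sub>1 y; G\<^sub>2 x]\<close>, whose norm is at most the sum over \<open>k\<close> of
  \<open>max \<parallel>g\<^sub>k\<parallel> \<cdot> \<parallel>(x\<^sub>k, y\<^sub>k)\<parallel>\<close>. So it suffices that
  \<open>\<parallel>(x\<^sub>k, y\<^sub>k)\<parallel> \<le> 2 \<parallel>r\<parallel> / \<delta>\<close> whenever step \<open>k\<close> is relaxed.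

  The padded eigenvector \<open>q~\<close> of the leading block of order \<open>l = k - 1\<close> has residual
  \<open>t\<^sub>l\<^sub>+\<^sub>1\<^sub>,\<^sub>l x\<^sub>l\<close> times a unit vector, hence of norm \<open>\<parallel>r\<parallel>\<close>. In the orthonormal basis \<open>[q~, Y]\<close>,
  the vector \<open>q~ + Y p\<close> is an eigenvector iff \<open>p\<close> solves a quadratic equation; since \<open>\<delta>\<close> bounds
  the compressed matrix from below, a solution with \<open>\<parallel>p\<parallel> \<le> 2 \<parallel>r\<parallel> / \<delta>\<close> exists, and its
  eigenvalue is so close to that of \<open>q~\<close> that it must be \<open>\<theta>\<close>. As \<open>\<theta>\<close> is simple, \<open>q\<close> is a multiple
  of \<open>q~ + Y p\<close>, and \<open>q~\<close> vanishes in the \<open>k\<close>-th components.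
\<close>

unbundle no vec_syntax

subsection \<open>Hermitian inner product and adjoint\<close>

text \<open>The conjugate sits on the second factor, so the products \<open>h\<^sup>* p\<close> of
  the matrix notation are written \<open>p \<bullet>c h\<close>. The product is linear in its first
  argument.\<close>

lemma cscalar_prod_sum:
  fixes v w :: "complex vec"
  assumes "w \<in> carrier_vec n"
  shows "v \<bullet>c w = (\<Sum>i<n. v $ i * cnj (w $ i))"
  using assms by (auto simp: scalar_prod_def lessThan_atLeast0 intro!: sum.cong)

lemma mult_mat_vec_sum:
  assumes "A \<in> carrier_mat a b" "x \<in> carrier_vec b" "i < a"
  shows "(A *\<^sub>v x) $ i = (\<Sum>j<b. A $$ (i, j) * x $ j)"
  using assms by (auto simp: scalar_prod_def lessThan_atLeast0 intro!: sum.cong)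

lemma cscalar_prod_commute:
  fixes v w :: "complex vec"
  assumes "v \<in> carrier_vec n" "w \<in> carrier_vec n"
  shows "v \<bullet>c w = cnj (w \<bullet>c v)"
  using assms by (simp add: cscalar_prod_sum[of _ n] mult.commute)

lemma cscalar_prod_add_left:
  fixes u v w :: "complex vec"
  assumes "u \<in> carrier_vec n" "v \<in> carrier_vec n" "w \<in> carrier_vec n"
  shows "(u + v) \<bullet>c w = u \<bullet>c w + v \<bullet>c w"
  using assms by (simp add: cscalar_prod_sum[of _ n] sum.distrib algebra_simps)

lemma cscalar_prod_diff_left:
  fixes u v w :: "complex vec"
  assumes "u \<in> carrier_vec n" "v \<in> carrier_vec n" "w \<in> carrier_vec n"
  shows "(u - v) \<bullet>c w = u \<bullet>c w - v \<bullet>c w"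
  using assms by (simp add: cscalar_prod_sum[of _ n] sum_subtractf algebra_simps)

lemma cscalar_prod_smult_left:
  fixes v w :: "complex vec"
  assumes "v \<in> carrier_vec n" "w \<in> carrier_vec n"
  shows "(c \<cdot>\<^sub>v v) \<bullet>c w = c * (v \<bullet>c w)"
  using assms by (simp add: cscalar_prod_sum[of _ n] sum_distrib_left algebra_simps)

lemma cscalar_prod_add_right:
  fixes u v w :: "complex vec"
  assumes "u \<in> carrier_vec n" "v \<in> carrier_vec n" "w \<in> carrier_vec n"
  shows "w \<bullet>c (u + v) = w \<bullet>c u + w \<bullet>c v"
  using assms by (simp add: cscalar_prod_sum[of _ n] sum.distrib algebra_simps)

lemma cscalar_prod_smult_right:
  fixes v w :: "complex vec"
  assumes "v \<in> carrier_vec n" "w \<in> carrier_vec n"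
  shows "w \<bullet>c (c \<cdot>\<^sub>v v) = cnj c * (w \<bullet>c v)"
  using assms by (simp add: cscalar_prod_sum[of _ n] sum_distrib_left algebra_simps)

section \<open>The Euclidean norm of complex vectors\<close>

lemma vnorm_eq_L2_set:
  assumes "v \<in> carrier_vec n"
  shows "vnorm v = L2_set (\<lambda>i. cmod (v $ i)) {..<n}"
  using assms by (auto simp: vnorm_def)

lemma vnorm_nonneg [simp]: "0 \<le> vnorm v"
  by (simp add: vnorm_def L2_set_nonneg)

lemma vnorm_power2:
  assumes "v \<in> carrier_vec n"
  shows "(vnorm v)\<^sup>2 = (\<Sum>i<n. (cmod (v $ i))\<^sup>2)"
  using assms by (simp add: vnorm_eq_L2_set L2_set_def sum_nonneg)

text \<open>Norm identities below are computed as complex inner products through this equation and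
  then carried back to the reals by injectivity of the embedding.\<close>

lemma of_real_vnorm_power2:
  assumes "v \<in> carrier_vec n"
  shows "complex_of_real ((vnorm v)\<^sup>2) = v \<bullet>c v"
  using assms by (simp add: vnorm_power2[OF assms] cscalar_prod_sum[OF assms] complex_norm_square
      del: of_real_power)

lemma vnorm_eq_0_iff:
  assumes "v \<in> carrier_vec n"
  shows "vnorm v = 0 \<longleftrightarrow> v = 0\<^sub>v n"
  using of_real_vnorm_power2[OF assms] conjugate_square_eq_0_vec[OF assms] by fastforce

lemma vnorm_triangle:
  assumes "v \<in> carrier_vec n" "w \<in> carrier_vec n"
  shows "vnorm (v + w) \<le> vnorm v + vnorm w"
proof -
  have "vnorm (v + w) = L2_set (\<lambda>i. cmod (v $ i + w $ i)) {..<n}"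
    using assms by (simp add: vnorm_eq_L2_set[of _ n] L2_set_def)
  also have "\<dots> \<le> L2_set (\<lambda>i. cmod (v $ i) + cmod (w $ i)) {..<n}"
    by (rule L2_set_mono) (auto simp: norm_triangle_ineq)
  also have "\<dots> \<le> vnorm v + vnorm w"
    using assms by (simp add: vnorm_eq_L2_set[of _ n] L2_set_triangle_ineq)
  finally show ?thesis .
qed

lemma vnorm_smult: "vnorm (c \<cdot>\<^sub>v v) = cmod c * vnorm v"
proof -
  have "vnorm (c \<cdot>\<^sub>v v) = L2_set (\<lambda>i. cmod c * cmod (v $ i)) {..<dim_vec v}"
    by (simp add: vnorm_def L2_set_def norm_mult)
  then show ?thesis
    by (simp add: vnorm_def L2_set_right_distrib)
qed

lemma vnorm_uminus: "vnorm (- v) = vnorm v"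
  by (simp add: vnorm_def L2_set_def)

lemma vnorm_ge_diff:
  assumes "v \<in> carrier_vec n" "w \<in> carrier_vec n"
  shows "vnorm v - vnorm w \<le> vnorm (v - w)"
proof -
  have "v = (v - w) + w"
    using assms by auto
  then show ?thesis
    using vnorm_triangle[of "v - w" n w] assms by simp
qed

lemma sum_lessThan_add:
  fixes f :: "nat \<Rightarrow> 'a :: comm_monoid_add"
  shows "(\<Sum>i<a + b. f i) = (\<Sum>i<a. f i) + (\<Sum>i<b. f (a + i))"
  by (induction b) (simp_all add: add.assoc)

lemma vnorm_append_power2:
  "(vnorm (v @\<^sub>v w))\<^sup>2 = (vnorm v)\<^sup>2 + (vnorm w)\<^sup>2"
proof -
  let ?a = "dim_vec v" and ?b = "dim_vec w"
  have "(vnorm (v @\<^sub>v w))\<^sup>2 = (\<Sum>i<?a + ?b. (cmod ((v @\<^sub>v w) $ i))\<^sup>2)"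
    by (rule vnorm_power2) auto
  also have "\<dots> = (\<Sum>i<?a. (cmod (v $ i))\<^sup>2) + (\<Sum>i<?b. (cmod (w $ i))\<^sup>2)"
    by (subst sum_lessThan_add) simp
  finally show ?thesis
    by (simp add: vnorm_power2[OF carrier_vec_dim_vec])
qed

lemma cmod_cscalar_prod_le:
  fixes v w :: "complex vec"
  assumes "v \<in> carrier_vec n" "w \<in> carrier_vec n"
  shows "cmod (v \<bullet>c w) \<le> vnorm v * vnorm w"
proof -
  have "cmod (v \<bullet>c w) \<le> (\<Sum>i<n. cmod (v $ i * cnj (w $ i)))"
    using assms by (simp only: cscalar_prod_sum norm_sum)
  also have "\<dots> = (\<Sum>i<n. \<bar>cmod (v $ i)\<bar> * \<bar>cmod (w $ i)\<bar>)"
    by (simp add: norm_mult)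
  also have "\<dots> \<le> vnorm v * vnorm w"
    using assms by (simp only: vnorm_eq_L2_set L2_set_mult_ineq)
  finally show ?thesis .
qed

section \<open>The conjugate transpose as adjoint\<close>

lemma mat_adjoint_carrier [simp]:
  "A \<in> carrier_mat a b \<Longrightarrow> mat_adjoint A \<in> carrier_mat b a"
  by (auto simp: mat_adjoint_def)

lemma dim_mat_adjoint [simp]:
  "dim_row (mat_adjoint A) = dim_col A" "dim_col (mat_adjoint A) = dim_row A"
  by (auto simp: mat_adjoint_def)

lemma index_mat_adjoint [simp]:
  fixes A :: "complex mat"
  shows "i < dim_col A \<Longrightarrow> j < dim_row A \<Longrightarrow> mat_adjoint A $$ (i, j) = cnj (A $$ (j, i))"
  by (auto simp: mat_adjoint_def mat_of_rows_def)

lemma mat_adjoint_adjoint [simp]: "mat_adjoint (mat_adjoint A) = (A :: complex mat)"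
  by (rule eq_matI) auto

lemma mat_adjoint_mult:
  fixes A B :: "complex mat"
  assumes "A \<in> carrier_mat a b" "B \<in> carrier_mat b c"
  shows "mat_adjoint (A * B) = mat_adjoint B * mat_adjoint A"
  using assms by (intro eq_matI) (auto simp: scalar_prod_def mult.commute intro!: sum.cong)

lemma cscalar_prod_mat_adjoint:
  fixes A :: "complex mat"
  assumes "A \<in> carrier_mat a b" "x \<in> carrier_vec b" "y \<in> carrier_vec a"
  shows "(A *\<^sub>v x) \<bullet>c y = x \<bullet>c (mat_adjoint A *\<^sub>v y)"
proof -
  have "(A *\<^sub>v x) \<bullet>c y = (\<Sum>i<a. \<Sum>j<b. A $$ (i, j) * x $ j * cnj (y $ i))"
    using assms by (simp add: cscalar_prod_sum[of _ a] mult_mat_vec_sum[of _ a b] sum_distrib_right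
        del: index_mult_mat_vec)
  also have "\<dots> = (\<Sum>j<b. \<Sum>i<a. A $$ (i, j) * x $ j * cnj (y $ i))"
    by (rule sum.swap)
  also have "\<dots> = (\<Sum>j<b. x $ j * cnj (\<Sum>i<a. mat_adjoint A $$ (j, i) * y $ i))"
    using assms by (intro sum.cong) (auto simp: sum_distrib_left intro!: sum.cong)
  also have "\<dots> = x \<bullet>c (mat_adjoint A *\<^sub>v y)"
    using assms mat_adjoint_carrier[OF assms(1)]
    by (subst cscalar_prod_sum[of _ b])
      (auto simp: mult_mat_vec_sum[of _ b a] mult_mat_vec_carrier[of _ b a] simp del: index_mult_mat_vec)
  finally show ?thesis .
qed

subsection \<open>Orthonormal completion of a unit vector\<close>

lemma mat_adjoint_mult_vec_carrier [simp]:
  "A \<in> carrier_mat a b \<Longrightarrow> mat_adjoint A *\<^sub>v w \<in> carrier_vec b"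
  by (intro carrier_vecI) auto

text \<open>This is unitarity of \<open>[q, Y]\<close> in the shape used later, with coordinates
  along \<open>q\<close> kept apart from those along \<open>Y\<close>. The last clause is the
  resolution of the identity \<open>q q\<^sup>* + Y Y\<^sup>* = I\<close>, applied to
  vectors.\<close>

definition orthonormal_split :: "nat \<Rightarrow> complex vec \<Rightarrow> complex mat \<Rightarrow> bool" where
  "orthonormal_split N q Y \<longleftrightarrow>
     q \<in> carrier_vec N \<and> Y \<in> carrier_mat N (N - 1) \<and> vnorm q = 1 \<and>
     mat_adjoint Y * Y = 1\<^sub>m (N - 1) \<and> mat_adjoint Y *\<^sub>v q = 0\<^sub>v (N - 1) \<and>
     (\<forall>w\<in>carrier_vec N. w = (w \<bullet>c q) \<cdot>\<^sub>v q + Y *\<^sub>v (mat_adjoint Y *\<^sub>v w))"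

lemma index_mat_adjoint_mult:
  fixes P Q :: "complex mat"
  assumes "P \<in> carrier_mat a b" "Q \<in> carrier_mat a c" "i < b" "j < c"
  shows "(mat_adjoint P * Q) $$ (i, j) = col Q j \<bullet>c col P i"
  using assms by (auto simp: scalar_prod_def mult.commute intro!: sum.cong)

lemma vnorm_eq_1_iff:
  assumes "q \<in> carrier_vec N"
  shows "vnorm q = 1 \<longleftrightarrow> q \<bullet>c q = 1"
proof -
  have "vnorm q = 1 \<longleftrightarrow> (vnorm q)\<^sup>2 = 1"
    using vnorm_nonneg[of q] by (metis one_power2 power2_eq_iff_nonneg zero_le_one)
  also have "\<dots> \<longleftrightarrow> complex_of_real ((vnorm q)\<^sup>2) = 1"
    by (simp only: of_real_eq_1_iff)
  finally show ?thesis
    by (simp only: of_real_vnorm_power2[OF assms])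
qed

text \<open>For \<open>Q = [q, Y]\<close>, the entries of \<open>Q\<^sup>* Q = I\<close> give the
  orthogonality relations, and \<open>Q Q\<^sup>* = I\<close> applied to \<open>w\<close> gives the
  expansion.\<close>

lemma orthonormal_split_of_unitary:
  assumes q: "q \<in> carrier_vec (Suc M)" and Y: "Y \<in> carrier_mat (Suc M) M"
    and U: "unitary_mat (mat_of_cols (Suc M) (q # cols Y))"
  shows "orthonormal_split (Suc M) q Y"
proof -
  define Q where "Q = mat_of_cols (Suc M) (q # cols Y)"
  have Q: "Q \<in> carrier_mat (Suc M) (Suc M)"
    using Y by (auto simp: Q_def)
  have QQ: "mat_adjoint Q * Q = 1\<^sub>m (Suc M)" "Q * mat_adjoint Q = 1\<^sub>m (Suc M)"
    using U Q by (auto simp: unitary_mat_def inverts_mat_def Q_def[symmetric])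
  have c0: "col Q 0 = q" and cS: "\<And>j. j < M \<Longrightarrow> col Q (Suc j) = col Y j"
    using q Y by (auto simp: Q_def)
  have orth: "col Q j \<bullet>c col Q i = (if i = j then 1 else 0)" if "i < Suc M" "j < Suc M" for i j
    using index_mat_adjoint_mult[OF Q Q that] QQ(1) that by simp
  have Q0: "Q $$ (i, 0) = q $ i" if "i < Suc M" for i
    using arg_cong[OF c0, of "\<lambda>v. v $ i"] Q that by simp
  have QS: "Q $$ (i, Suc j) = Y $$ (i, j)" if "i < Suc M" "j < M" for i j
    using arg_cong[OF cS[OF that(2)], of "\<lambda>v. v $ i"] Q Y that by simp
  have "vnorm q = 1"
    using orth[of 0 0] vnorm_eq_1_iff[OF q] by (simp add: c0)
  moreover have "mat_adjoint Y * Y = 1\<^sub>m M"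
  proof (rule eq_matI)
    fix i j assume "i < dim_row (1\<^sub>m M :: complex mat)" "j < dim_col (1\<^sub>m M :: complex mat)"
    then have ij: "i < M" "j < M" by auto
    show "(mat_adjoint Y * Y) $$ (i, j) = 1\<^sub>m M $$ (i, j)"
      using orth[of "Suc i" "Suc j"] index_mat_adjoint_mult[OF Y Y ij] ij
      by (simp add: cS[OF ij(1)] cS[OF ij(2)])
  qed (use Y in auto)
  moreover have "mat_adjoint Y *\<^sub>v q = 0\<^sub>v M"
  proof (rule eq_vecI)
    fix i assume "i < dim_vec (0\<^sub>v M :: complex vec)"
    then have i: "i < M" by auto
    have "(mat_adjoint Y *\<^sub>v q) $ i = q \<bullet>c col Y i"
      using q Y i by (auto simp: scalar_prod_def mult.commute intro!: sum.cong)
    then show "(mat_adjoint Y *\<^sub>v q) $ i = 0\<^sub>v M $ i"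
      using orth[of "Suc i" 0] i by (simp add: c0 cS)
  qed (use Y in auto)
  moreover have "w = (w \<bullet>c q) \<cdot>\<^sub>v q + Y *\<^sub>v (mat_adjoint Y *\<^sub>v w)"
    if w: "w \<in> carrier_vec (Suc M)" for w
  proof (rule eq_vecI)
    fix i assume "i < dim_vec ((w \<bullet>c q) \<cdot>\<^sub>v q + Y *\<^sub>v (mat_adjoint Y *\<^sub>v w))"
    then have i: "i < Suc M" using Y by auto
    \<comment> \<open>These are the coordinates of \<open>w\<close> in the columns of
      \<open>Q\<close>: entry 0 is the coefficient of \<open>q\<close>, the remaining ones form
      \<open>Y\<^sup>* w\<close>.\<close>
    define z where "z = mat_adjoint Q *\<^sub>v w"
    have z: "z \<in> carrier_vec (Suc M)"
      using Q by (auto simp: z_def)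
    have z0: "z $ 0 = w \<bullet>c q"
      using Q w q by (auto simp: z_def scalar_prod_def Q0 mult.commute intro!: sum.cong)
    have zS: "z $ Suc j = (mat_adjoint Y *\<^sub>v w) $ j" if "j < M" for j
      using Q w q Y that by (auto simp: z_def scalar_prod_def QS intro!: sum.cong)
    have "Q *\<^sub>v z = (Q * mat_adjoint Q) *\<^sub>v w"
      unfolding z_def using Q w by (intro assoc_mult_mat_vec[symmetric]) auto
    then have "w $ i = (Q *\<^sub>v z) $ i"
      using QQ w by simp
    also have "\<dots> = (\<Sum>j<Suc M. Q $$ (i, j) * z $ j)"
      by (rule mult_mat_vec_sum[OF Q z i])
    also have "\<dots> = Q $$ (i, 0) * z $ 0 + (\<Sum>j<M. Q $$ (i, Suc j) * z $ Suc j)"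
      by (rule sum.lessThan_Suc_shift)
    also have "(\<Sum>j<M. Q $$ (i, Suc j) * z $ Suc j) = (\<Sum>j<M. Y $$ (i, j) * (mat_adjoint Y *\<^sub>v w) $ j)"
      using i by (intro sum.cong) (auto simp: QS zS simp del: index_mult_mat_vec)
    also have "\<dots> = (Y *\<^sub>v (mat_adjoint Y *\<^sub>v w)) $ i"
      using Y by (intro mult_mat_vec_sum[symmetric, OF Y _ i]) auto
    finally show "w $ i = ((w \<bullet>c q) \<cdot>\<^sub>v q + Y *\<^sub>v (mat_adjoint Y *\<^sub>v w)) $ i"
      using i q Y by (simp add: Q0 z0 mult.commute del: index_mult_mat_vec)
  qed (use w Y q in auto)
  ultimately show ?thesis
    using q Y by (simp add: orthonormal_split_def)
qed

text \<open>Extend \<open>q\<close> to a basis, orthogonalize by Gram-Schmidt, which keeps the first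
  vector, and normalize. Existence is what makes the choice in \<open>unitary_completion\<close>
  meaningful.\<close>

lemma unitary_completion_exists:
  assumes q: "q \<in> carrier_vec (Suc M)" and norm: "vnorm q = 1"
  shows "\<exists>Y. Y \<in> carrier_mat (Suc M) M \<and> unitary_mat (mat_of_cols (Suc M) (q # cols Y))"
proof -
  interpret cof_vec_space "Suc M" "TYPE(complex)" .
  have q0: "q \<noteq> 0\<^sub>v (Suc M)"
    using norm vnorm_eq_0_iff[OF q] by auto
  define b where "b = basis_completion q"
  define ws where "ws = gram_schmidt (Suc M) b"
  note bc = basis_completion[OF q q0, folded b_def]
  obtain bs where b: "b = q # bs"
    using bc(6,7) by (cases b) auto
  note gs = gram_schmidt_result[OF bc(2,4,5) ws_def]
  have hd: "hd ws = q"
    using gram_schmidt_hd[OF q] by (simp add: ws_def b)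
  have len: "length ws = Suc M"
    using gs(4) bc(6) by simp
  \<comment> \<open>The Gram-Schmidt vectors are orthogonal and nonzero but not of unit length.
    Scaling fixes the head, since \<open>q\<close> already has norm 1.\<close>
  define us where "us = map (\<lambda>w. complex_of_real (1 / vnorm w) \<cdot>\<^sub>v w) ws"
  have us: "set us \<subseteq> carrier_vec (Suc M)" and lenu: "length us = Suc M"
    using gs(3) len by (auto simp: us_def)
  have "us \<noteq> []" using lenu by auto
  moreover have "hd us = q"
    using hd len norm q by (cases ws) (auto simp: us_def)
  ultimately have us_Cons: "q # tl us = us"
    using list.collapse by fastforce
  define Y where "Y = mat_of_cols (Suc M) (tl us)"
  have Y: "Y \<in> carrier_mat (Suc M) M"
    using lenu by (auto simp: Y_def)
  have "set (tl us) \<subseteq> carrier_vec (Suc M)"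
    using us by (auto dest: list.set_sel(2)[OF \<open>us \<noteq> []\<close>])
  then have cols: "q # cols Y = us"
    by (simp add: Y_def us_Cons)
  define Q where "Q = mat_of_cols (Suc M) us"
  have Q: "Q \<in> carrier_mat (Suc M) (Suc M)"
    using lenu by (auto simp: Q_def)
  have QQ: "mat_adjoint Q * Q = 1\<^sub>m (Suc M)"
  proof (rule eq_matI)
    fix i j assume "i < dim_row (1\<^sub>m (Suc M) :: complex mat)" "j < dim_col (1\<^sub>m (Suc M) :: complex mat)"
    then have ij: "i < Suc M" "j < Suc M" by auto
    have c: "ws ! i \<in> carrier_vec (Suc M)" "ws ! j \<in> carrier_vec (Suc M)"
      using gs(3) ij len by (metis nth_mem subsetD)+
    have "(mat_adjoint Q * Q) $$ (i, j) = us ! j \<bullet>c us ! i"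
    proof -
      have "us ! i \<in> carrier_vec (Suc M)" "us ! j \<in> carrier_vec (Suc M)"
        using us ij lenu by (metis nth_mem subsetD)+
      then show ?thesis
        using ij lenu unfolding index_mat_adjoint_mult[OF Q Q ij] unfolding Q_def by simp
    qed
    also have "\<dots> = complex_of_real (1 / vnorm (ws ! j)) * (complex_of_real (1 / vnorm (ws ! i)) * (ws ! j \<bullet>c ws ! i))"
      using ij len c
      by (simp add: us_def cscalar_prod_smult_left[of _ "Suc M"] cscalar_prod_smult_right[of _ "Suc M"])
    also have "\<dots> = (if i = j then 1 else 0)"
    proof (cases "i = j")
      case True
      have "ws ! i \<bullet>c ws ! i \<noteq> 0"
        using corthogonalD[OF gs(2), of i i] ij len by simp
      moreover have "ws ! i \<bullet>c ws ! i = complex_of_real (vnorm (ws ! i)) * complex_of_real (vnorm (ws ! i))"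
        using of_real_vnorm_power2[OF c(1)] by (simp add: power2_eq_square)
      ultimately show ?thesis
        using True by simp
    next
      case False
      then show ?thesis
        using corthogonalD[OF gs(2), of j i] ij len by simp
    qed
    finally show "(mat_adjoint Q * Q) $$ (i, j) = 1\<^sub>m (Suc M) $$ (i, j)"
      using ij by simp
  qed (use Q in auto)
  moreover have "Q * mat_adjoint Q = 1\<^sub>m (Suc M)"
    using mat_mult_left_right_inverse[OF _ Q QQ] Q by simp
  ultimately have "unitary_mat Q"
    using Q by (auto simp: unitary_mat_def inverts_mat_def)
  then show ?thesis
    using Y cols by (auto simp: Q_def)
qed

lemma unitary_completion_unitary:
  assumes "q \<in> carrier_vec N" "vnorm q = 1"
  shows "unitary_completion q \<in> carrier_mat N (N - 1)"
    and "unitary_mat (mat_of_cols N (q # cols (unitary_completion q)))"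
    and "orthonormal_split N q (unitary_completion q)"
proof -
  \<comment> \<open>The empty vector has norm 0, so a unit vector forces \<open>N\<close> to be
    positive and \<open>N - 1\<close> is a true subtraction.\<close>
  have "N \<noteq> 0"
    using assms by (intro notI) (simp add: vnorm_def)
  then obtain M where N: "N = Suc M"
    by (cases N) auto
  have "unitary_completion q \<in> carrier_mat N (N - 1) \<and>
      unitary_mat (mat_of_cols N (q # cols (unitary_completion q)))"
    using someI_ex[OF unitary_completion_exists[of q M]] assms
    by (simp add: unitary_completion_def N)
  then show "unitary_completion q \<in> carrier_mat N (N - 1)"
    and "unitary_mat (mat_of_cols N (q # cols (unitary_completion q)))"
    by auto
  then show "orthonormal_split N q (unitary_completion q)"
    using orthonormal_split_of_unitary[of q M] assms by (simp add: N)
qed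

lemma orthonormal_splitD:
  assumes "orthonormal_split N q Y"
  shows "q \<in> carrier_vec N" "Y \<in> carrier_mat N (N - 1)" "vnorm q = 1" "q \<bullet>c q = 1"
    "mat_adjoint Y * Y = 1\<^sub>m (N - 1)" "mat_adjoint Y *\<^sub>v q = 0\<^sub>v (N - 1)"
    "w \<in> carrier_vec N \<Longrightarrow> w = (w \<bullet>c q) \<cdot>\<^sub>v q + Y *\<^sub>v (mat_adjoint Y *\<^sub>v w)"
  using assms vnorm_eq_1_iff[of q N] by (auto simp: orthonormal_split_def)

lemma orthonormal_split_mult_carrier:
  assumes "orthonormal_split N q Y"
  shows "Y *\<^sub>v z \<in> carrier_vec N"
  using orthonormal_splitD(2)[OF assms] by (intro carrier_vecI) auto

lemma orthonormal_split_adjoint_mult: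
  assumes s: "orthonormal_split N q Y" and z: "z \<in> carrier_vec (N - 1)"
  shows "mat_adjoint Y *\<^sub>v (Y *\<^sub>v z) = z"
proof -
  have "mat_adjoint Y *\<^sub>v (Y *\<^sub>v z) = (mat_adjoint Y * Y) *\<^sub>v z"
    using orthonormal_splitD(2)[OF s] z by (intro assoc_mult_mat_vec[symmetric]) auto
  then show ?thesis
    using orthonormal_splitD(5)[OF s] z by simp
qed

lemma orthonormal_split_orthogonal:
  assumes s: "orthonormal_split N q Y" and z: "z \<in> carrier_vec (N - 1)"
  shows "(Y *\<^sub>v z) \<bullet>c q = 0" "q \<bullet>c (Y *\<^sub>v z) = 0"
proof -
  note d = orthonormal_splitD[OF s]
  show *: "(Y *\<^sub>v z) \<bullet>c q = 0"
    using cscalar_prod_mat_adjoint[OF d(2) z d(1)] z by (simp add: d(6))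
  show "q \<bullet>c (Y *\<^sub>v z) = 0"
    using cscalar_prod_commute[OF d(1) orthonormal_split_mult_carrier[OF s, of z]] * by simp
qed

lemma orthonormal_split_cscalar_prod:
  assumes s: "orthonormal_split N q Y" and z: "z \<in> carrier_vec (N - 1)" and w: "w \<in> carrier_vec (N - 1)"
  shows "(Y *\<^sub>v z) \<bullet>c (Y *\<^sub>v w) = z \<bullet>c w"
  using cscalar_prod_mat_adjoint[OF orthonormal_splitD(2)[OF s] z orthonormal_split_mult_carrier[OF s]]
    orthonormal_split_adjoint_mult[OF s w] by simp

text \<open>Pythagoras: \<open>q\<close> is orthogonal to the range of \<open>Y\<close>, and
  \<open>Y\<close> is an isometry.\<close>

lemma orthonormal_split_vnorm:
  assumes s: "orthonormal_split N q Y" and z: "z \<in> carrier_vec (N - 1)"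
  shows "(vnorm (\<alpha> \<cdot>\<^sub>v q + Y *\<^sub>v z))\<^sup>2 = (cmod \<alpha>)\<^sup>2 + (vnorm z)\<^sup>2"
proof -
  note d = orthonormal_splitD[OF s]
  note c = orthonormal_split_mult_carrier[OF s]
  have "complex_of_real ((vnorm (\<alpha> \<cdot>\<^sub>v q + Y *\<^sub>v z))\<^sup>2) =
      (\<alpha> \<cdot>\<^sub>v q + Y *\<^sub>v z) \<bullet>c (\<alpha> \<cdot>\<^sub>v q + Y *\<^sub>v z)"
    using d(1) c by (intro of_real_vnorm_power2[of _ N]) auto
  also have "\<dots> = \<alpha> * cnj \<alpha> + z \<bullet>c z"
    using d(1) c[of z]
    by (simp add: cscalar_prod_add_left[of _ N] cscalar_prod_add_right[of _ N] cscalar_prod_smult_left[of _ N]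
      cscalar_prod_smult_right[of _ N] orthonormal_split_orthogonal[OF s z]
      orthonormal_split_cscalar_prod[OF s z z] d(4))
  also have "\<dots> = complex_of_real ((cmod \<alpha>)\<^sup>2 + (vnorm z)\<^sup>2)"
    by (simp only: of_real_add of_real_vnorm_power2[OF z] complex_norm_square)
  finally show ?thesis
    by (simp only: of_real_eq_iff)
qed

lemma orthonormal_split_vnorm_mult:
  assumes s: "orthonormal_split N q Y" and z: "z \<in> carrier_vec (N - 1)"
  shows "vnorm (Y *\<^sub>v z) = vnorm z"
proof -
  have "complex_of_real ((vnorm (Y *\<^sub>v z))\<^sup>2) = complex_of_real ((vnorm z)\<^sup>2)"
    unfolding of_real_vnorm_power2[OF z] of_real_vnorm_power2[OF orthonormal_split_mult_carrier[OF s]]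
    by (rule orthonormal_split_cscalar_prod[OF s z z])
  then show ?thesis
    by (simp only: of_real_eq_iff power2_eq_iff_nonneg vnorm_nonneg)
qed

text \<open>Bessel's inequality: the component of \<open>w\<close> along \<open>q\<close> is dropped
  from Pythagoras.\<close>

lemma orthonormal_split_vnorm_adjoint_le:
  assumes s: "orthonormal_split N q Y" and w: "w \<in> carrier_vec N"
  shows "vnorm (mat_adjoint Y *\<^sub>v w) \<le> vnorm w"
proof -
  have "(vnorm w)\<^sup>2 = (cmod (w \<bullet>c q))\<^sup>2 + (vnorm (mat_adjoint Y *\<^sub>v w))\<^sup>2"
    using orthonormal_split_vnorm[OF s, of "mat_adjoint Y *\<^sub>v w" "w \<bullet>c q"]
      orthonormal_splitD(7)[OF s w] mat_adjoint_mult_vec_carrier[OF orthonormal_splitD(2)[OF s], of w] by simp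
  then have "(vnorm (mat_adjoint Y *\<^sub>v w))\<^sup>2 \<le> (vnorm w)\<^sup>2"
    by simp
  then show ?thesis
    by (simp add: power2_le_iff_abs_le)
qed

subsection \<open>The smallest singular value as a lower bound\<close>

text \<open>Deflation: splitting off a unit eigenvector of \<open>H\<close> leaves a Hermitian matrix of smaller size
  all of whose eigenvalues are eigenvalues of \<open>H\<close>.\<close>

lemma hermitian_form_ge:
  fixes H :: "complex mat"
  assumes "H \<in> carrier_mat N N" "mat_adjoint H = H" "\<And>\<mu>. eigenvalue H \<mu> \<Longrightarrow> c \<le> Re \<mu>"
    and "x \<in> carrier_vec N"
  shows "c * (vnorm x)\<^sup>2 \<le> Re ((H *\<^sub>v x) \<bullet>c x)"
  using assms
proof (induction N arbitrary: H x)
  case 0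
  then show ?case
    by (simp add: vnorm_power2[of _ 0] scalar_prod_def)
next
  case (Suc M)
  note H = Suc.prems(1) and Hh = Suc.prems(2) and x = Suc.prems(4)
  obtain ev where ev: "eigenvalue H ev"
    using spectrum_non_empty[OF H] by (auto simp: spectrum_def)
  then obtain v where v: "v \<in> carrier_vec (Suc M)" "v \<noteq> 0\<^sub>v (Suc M)" "H *\<^sub>v v = ev \<cdot>\<^sub>v v"
    using H by (auto simp: eigenvalue_def eigenvector_def)
  define q where "q = complex_of_real (1 / vnorm v) \<cdot>\<^sub>v v"
  have q: "q \<in> carrier_vec (Suc M)" and nq: "vnorm q = 1"
    using v vnorm_eq_0_iff[OF v(1)] by (auto simp: q_def vnorm_smult norm_divide)
  have Hq: "H *\<^sub>v q = ev \<cdot>\<^sub>v q"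
    using v H by (simp add: q_def mult_mat_vec[of _ "Suc M" "Suc M"] smult_smult_assoc mult.commute)
  define Y where "Y = unitary_completion q"
  have s: "orthonormal_split (Suc M) q Y"
    unfolding Y_def by (rule unitary_completion_unitary(3)[OF q nq])
  note d = orthonormal_splitD[OF s, simplified]
  note Yc = orthonormal_split_mult_carrier[OF s]
  \<comment> \<open>This is the compression of \<open>H\<close> to the orthogonal complement of
    \<open>q\<close>, in the coordinates given by \<open>Y\<close>.\<close>
  define H' where "H' = mat_adjoint Y * (H * Y)"
  have H': "H' \<in> carrier_mat M M"
    using H d(2) by (auto simp: H'_def)
  have HYc: "H *\<^sub>v (Y *\<^sub>v z) \<in> carrier_vec (Suc M)" for z
    using H by (intro carrier_vecI) auto
  have H'v: "H' *\<^sub>v z = mat_adjoint Y *\<^sub>v (H *\<^sub>v (Y *\<^sub>v z))" if "z \<in> carrier_vec M" for z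
    using that H d(2) assoc_mult_mat_vec[of "mat_adjoint Y" M "Suc M" "H * Y" M z]
      assoc_mult_mat_vec[of H "Suc M" "Suc M" Y M z] by (simp add: H'_def)
  \<comment> \<open>The complement of \<open>q\<close> is invariant: moving the Hermitian
    \<open>H\<close> to the other side turns \<open>q\<close> into a multiple of itself, which is
    orthogonal to \<open>Y z\<close>.\<close>
  have HYq: "(H *\<^sub>v (Y *\<^sub>v z)) \<bullet>c q = 0" if "z \<in> carrier_vec M" for z
    using cscalar_prod_mat_adjoint[OF H Yc q] orthonormal_split_orthogonal[OF s] that q Yc
    by (simp add: Hh Hq cscalar_prod_smult_right[of _ "Suc M"])
  have "mat_adjoint H' = H'"
    using H d(2) mat_adjoint_mult[of "mat_adjoint Y" M "Suc M" "H * Y" M]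
      mat_adjoint_mult[of H "Suc M" "Suc M" Y M] assoc_mult_mat[of "mat_adjoint Y" M "Suc M" H "Suc M" Y M]
    by (simp add: H'_def Hh)
  moreover have "c \<le> Re \<mu>" if ev': "eigenvalue H' \<mu>" for \<mu>
  proof -
    obtain w where w: "w \<in> carrier_vec M" "w \<noteq> 0\<^sub>v M" "H' *\<^sub>v w = \<mu> \<cdot>\<^sub>v w"
      using ev' H' by (auto simp: eigenvalue_def eigenvector_def)
    \<comment> \<open>An eigenvector \<open>w\<close> of \<open>H'\<close> lifts to
      \<open>Y w\<close>: by invariance \<open>H (Y w)\<close> has no part along \<open>q\<close>.
      The lift is nonzero because \<open>Y\<close> preserves norms.\<close>
    have "H *\<^sub>v (Y *\<^sub>v w) = 0 \<cdot>\<^sub>v q + Y *\<^sub>v (\<mu> \<cdot>\<^sub>v w)"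
      using d(7)[OF HYc[of w]] H'v[OF w(1)] HYq[OF w(1)] w(3) by simp
    also have "\<dots> = \<mu> \<cdot>\<^sub>v (Y *\<^sub>v w)"
      using d(2) q w(1) Yc[of w] mult_mat_vec[of Y "Suc M" M w \<mu>] by auto
    finally have "H *\<^sub>v (Y *\<^sub>v w) = \<mu> \<cdot>\<^sub>v (Y *\<^sub>v w)" .
    moreover have "Y *\<^sub>v w \<noteq> 0\<^sub>v (Suc M)"
      using orthonormal_split_vnorm_mult[OF s, of w] w vnorm_eq_0_iff[of w M] vnorm_eq_0_iff[OF Yc, of w]
      by simp
    ultimately have "eigenvalue H \<mu>"
      using H Yc by (auto simp: eigenvalue_def eigenvector_def)
    then show ?thesis
      by (rule Suc.prems(3))
  qed
  ultimately have IH: "c * (vnorm z)\<^sup>2 \<le> Re ((H' *\<^sub>v z) \<bullet>c z)" if "z \<in> carrier_vec M" for z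
    using Suc.IH[OF H'] that by blast
  define \<alpha> where "\<alpha> = x \<bullet>c q"
  define z where "z = mat_adjoint Y *\<^sub>v x"
  have z: "z \<in> carrier_vec M"
    using d(2) by (simp add: z_def)
  have xd: "x = \<alpha> \<cdot>\<^sub>v q + Y *\<^sub>v z"
    unfolding \<alpha>_def z_def by (rule d(7)[OF x])
  have "H *\<^sub>v x = (\<alpha> * ev) \<cdot>\<^sub>v q + H *\<^sub>v (Y *\<^sub>v z)"
    unfolding xd using H q Yc
    by (simp add: mult_add_distrib_mat_vec[of _ "Suc M" "Suc M"] mult_mat_vec[of _ "Suc M" "Suc M"] Hq smult_smult_assoc)
  \<comment> \<open>Both cross terms vanish, one by orthogonality of \<open>q\<close> and
    \<open>Y z\<close>, the other by invariance of the complement.\<close>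
  then have "(H *\<^sub>v x) \<bullet>c x = \<alpha> * cnj \<alpha> * ev + (H *\<^sub>v (Y *\<^sub>v z)) \<bullet>c (Y *\<^sub>v z)"
    using q Yc[of z] HYc[of z] HYq[OF z] orthonormal_split_orthogonal[OF s] z d(4)
    by (subst (2) xd) (simp add: cscalar_prod_add_left[of _ "Suc M"] cscalar_prod_add_right[of _ "Suc M"]
        cscalar_prod_smult_left[of _ "Suc M"] cscalar_prod_smult_right[of _ "Suc M"])
  also have "(H *\<^sub>v (Y *\<^sub>v z)) \<bullet>c (Y *\<^sub>v z) = (H' *\<^sub>v z) \<bullet>c z"
    using cscalar_prod_mat_adjoint[of "mat_adjoint Y" M "Suc M" "H *\<^sub>v (Y *\<^sub>v z)" z] d(2) z HYc
    by (simp add: H'v)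
  also have "\<alpha> * cnj \<alpha> = complex_of_real ((cmod \<alpha>)\<^sup>2)"
    by (simp only: complex_norm_square)
  finally have "Re ((H *\<^sub>v x) \<bullet>c x) = (cmod \<alpha>)\<^sup>2 * Re ev + Re ((H' *\<^sub>v z) \<bullet>c z)"
    by simp
  moreover have "(vnorm x)\<^sup>2 = (cmod \<alpha>)\<^sup>2 + (vnorm z)\<^sup>2"
    using orthonormal_split_vnorm[OF s, of z \<alpha>] z by (simp add: xd[symmetric])
  moreover have "(cmod \<alpha>)\<^sup>2 * c \<le> (cmod \<alpha>)\<^sup>2 * Re ev"
    using Suc.prems(3)[OF ev] by (intro mult_left_mono) auto
  ultimately show ?case
    using IH[OF z] by (simp add: algebra_simps)
qed

text \<open>The quadratic form of \<open>C\<^sup>* C\<close> is the square of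
  \<open>vnorm (C x)\<close>, and its eigenvalues are the squared singular values, so the bound for
  Hermitian forms applies with the constant \<open>(sigma_min C)\<^sup>2\<close>.\<close>

lemma sigma_min_mult_vnorm_le:
  assumes C: "C \<in> carrier_mat N N" and pos: "sigma_min C > 0" and x: "x \<in> carrier_vec N"
  shows "sigma_min C * vnorm x \<le> vnorm (C *\<^sub>v x)"
proof -
  let ?H = "mat_adjoint C * C"
  have H: "?H \<in> carrier_mat N N"
    using C by (intro mult_carrier_mat) auto
  have fin: "finite (singular_values C)"
  proof -
    have "singular_values C = (\<lambda>\<mu>. sqrt (Re \<mu>)) ` spectrum ?H"
      by (auto simp: singular_values_def spectrum_def)
    then show ?thesis
      using card_finite_spectrum(1)[OF H] by simp
  qed
  have "(sigma_min C)\<^sup>2 \<le> Re \<mu>" if "eigenvalue ?H \<mu>" for \<mu>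
  proof -
    have "sigma_min C \<le> sqrt (Re \<mu>)"
      unfolding sigma_min_def using that by (intro Min_le[OF fin]) (auto simp: singular_values_def)
    \<comment> \<open>The real \<open>sqrt\<close> is negative on negative arguments. Positivity of
      \<open>sigma_min C\<close> therefore forces \<open>Re \<mu> > 0\<close>, and only then does
      squaring the root return \<open>Re \<mu>\<close>.\<close>
    then show ?thesis
      using pos by (metis less_eq_real_def real_sqrt_gt_0_iff real_sqrt_pow2 order_less_le_trans power_mono)
  qed
  moreover have "mat_adjoint ?H = ?H"
    using C mat_adjoint_mult[of "mat_adjoint C" N N C N] by simp
  ultimately have "(sigma_min C)\<^sup>2 * (vnorm x)\<^sup>2 \<le> Re ((?H *\<^sub>v x) \<bullet>c x)"
    using hermitian_form_ge[OF H _ _ x] by blast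
  also have "(?H *\<^sub>v x) \<bullet>c x = complex_of_real ((vnorm (C *\<^sub>v x))\<^sup>2)"
    using cscalar_prod_mat_adjoint[of "mat_adjoint C" N N "C *\<^sub>v x" x]
      of_real_vnorm_power2[of "C *\<^sub>v x" N] C x assoc_mult_mat_vec[of "mat_adjoint C" N N C N x] by simp
  finally have "(sigma_min C * vnorm x)\<^sup>2 \<le> (vnorm (C *\<^sub>v x))\<^sup>2"
    by (simp add: power_mult_distrib)
  then show ?thesis
    by (rule power2_le_imp_le) simp
qed

subsection \<open>Perturbation of an approximate eigenpair\<close>

lemma smult_one_mult_vec:
  fixes x :: "complex vec"
  assumes "x \<in> carrier_vec M"
  shows "(a \<cdot>\<^sub>m 1\<^sub>m M) *\<^sub>v x = a \<cdot>\<^sub>v x"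
proof (rule eq_vecI)
  fix i assume "i < dim_vec (a \<cdot>\<^sub>v x)"
  then have i: "i < M" using assms by simp
  have "((a \<cdot>\<^sub>m 1\<^sub>m M) *\<^sub>v x) $ i = (\<Sum>j<M. (a \<cdot>\<^sub>m 1\<^sub>m M) $$ (i, j) * x $ j)"
    using assms i by (intro mult_mat_vec_sum[of _ M]) auto
  also have "\<dots> = (\<Sum>j<M. if i = j then a * x $ j else 0)"
    using i by (intro sum.cong) auto
  finally show "((a \<cdot>\<^sub>m 1\<^sub>m M) *\<^sub>v x) $ i = (a \<cdot>\<^sub>v x) $ i"
    using i assms by simp
qed (use assms in auto)

text \<open>A trivial kernel means a nonzero determinant, hence an inverse in the ring of square
  matrices.\<close>

lemma injective_imp_solvable:
  fixes C :: "complex mat"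
  assumes C: "C \<in> carrier_mat M M" and inj: "\<And>x. x \<in> carrier_vec M \<Longrightarrow> C *\<^sub>v x = 0\<^sub>v M \<Longrightarrow> x = 0\<^sub>v M"
    and b: "b \<in> carrier_vec M"
  shows "\<exists>x\<in>carrier_vec M. C *\<^sub>v x = b"
proof -
  have "det C \<noteq> 0"
    using det_0_iff_vec_prod_zero_field[OF C] inj by blast
  from det_non_zero_imp_unit[OF C this, of "()"]
  obtain D where D: "D \<in> carrier_mat M M" "C * D = 1\<^sub>m M"
    by (auto simp: Units_def ring_mat_def)
  have "C *\<^sub>v (D *\<^sub>v b) = b"
    using assoc_mult_mat_vec[OF C D(1) b] D b by simp
  then show ?thesis
    using D(1) b by (intro bexI[of _ "D *\<^sub>v b"]) auto
qed

text \<open>Eliminating \<open>p\<close> reduces the quadratic equation \<open>C p - (h\<^sup>* p) p = - g\<close> to the scalar fixed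
  point equation \<open>\<lambda> = h\<^sup>* (\<lambda> - C)\<^sup>-\<^sup>1 g\<close>, to which the contraction principle applies on a disc of
  radius below \<open>\<delta> / 2\<close>.\<close>

lemma quadratic_system_solution:
  fixes C :: "complex mat"
  assumes C: "C \<in> carrier_mat M M" and g: "g \<in> carrier_vec M" and h: "h \<in> carrier_vec M"
    and \<delta>: "\<delta> > 0" and low: "\<And>x. x \<in> carrier_vec M \<Longrightarrow> \<delta> * vnorm x \<le> vnorm (C *\<^sub>v x)"
    and small: "vnorm g * vnorm h < \<delta>\<^sup>2 / 4"
  obtains p where "p \<in> carrier_vec M" "C *\<^sub>v p - (p \<bullet>c h) \<cdot>\<^sub>v p = - g" "vnorm p \<le> 2 * vnorm g / \<delta>"
proof -
  \<comment> \<open>This is the largest value that \<open>cmod (p \<bullet>c h)\<close> can take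
    when \<open>vnorm p \<le> 2 * vnorm g / \<delta>\<close>. The smallness hypothesis says exactly
    that it stays below \<open>\<delta> / 2\<close>.\<close>
  define \<rho> where "\<rho> = 2 * (vnorm g * vnorm h) / \<delta>"
  have \<rho>: "0 \<le> \<rho>" "\<rho> < \<delta> / 2"
    using \<delta> small by (auto simp: \<rho>_def field_simps power2_eq_square)
  \<comment> \<open>Shifting \<open>C\<close> by a scalar of modulus below
    \<open>\<delta> / 2\<close> costs at most half of the lower bound.\<close>
  have low': "\<delta> / 2 * vnorm x \<le> vnorm (C *\<^sub>v x - a \<cdot>\<^sub>v x)"
    if x: "x \<in> carrier_vec M" and a: "cmod a \<le> \<rho>" for x a
  proof -
    have "cmod a * vnorm x \<le> \<delta> / 2 * vnorm x"
      using a \<rho> by (intro mult_right_mono) auto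
    moreover have "vnorm (C *\<^sub>v x) - vnorm (a \<cdot>\<^sub>v x) \<le> vnorm (C *\<^sub>v x - a \<cdot>\<^sub>v x)"
      using C x by (intro vnorm_ge_diff[of _ M]) auto
    ultimately show ?thesis
      using low[OF x] by (simp add: vnorm_smult algebra_simps)
  qed
  have "\<exists>p\<in>carrier_vec M. C *\<^sub>v p - a \<cdot>\<^sub>v p = - g" if a: "cmod a \<le> \<rho>" for a
  proof -
    define D where "D = C - a \<cdot>\<^sub>m 1\<^sub>m M"
    have D: "D \<in> carrier_mat M M"
      using C by (simp add: D_def minus_carrier_mat)
    have Dx: "D *\<^sub>v x = C *\<^sub>v x - a \<cdot>\<^sub>v x" if "x \<in> carrier_vec M" for x
      using C that by (simp add: D_def minus_mult_distrib_mat_vec[of _ M M] smult_one_mult_vec)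
    have "x = 0\<^sub>v M" if x: "x \<in> carrier_vec M" "D *\<^sub>v x = 0\<^sub>v M" for x
    proof -
      have "vnorm (0\<^sub>v M) = 0"
        using vnorm_eq_0_iff[of "0\<^sub>v M" M] by simp
      then have "\<delta> / 2 * vnorm x \<le> 0"
        using low'[OF x(1) a] Dx[OF x(1)] x(2) by simp
      then show ?thesis
        using \<delta> vnorm_nonneg[of x] vnorm_eq_0_iff[OF x(1)] by (simp add: mult_le_0_iff)
    qed
    from injective_imp_solvable[OF D this, of "- g"] g Dx show ?thesis
      by fastforce
  qed
  \<comment> \<open>\<open>P a\<close> is the resolvent applied to \<open>g\<close>, that is
    \<open>(a - C)\<^sup>-\<^sup>1 g\<close>. A fixed point of
    \<open>a \<mapsto> P a \<bullet>c h\<close> yields the solution of the quadratic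
    equation.\<close>
  then obtain P where P: "\<And>a. cmod a \<le> \<rho> \<Longrightarrow> P a \<in> carrier_vec M"
    and eq: "\<And>a. cmod a \<le> \<rho> \<Longrightarrow> C *\<^sub>v P a - a \<cdot>\<^sub>v P a = - g"
    by metis
  have Pn: "vnorm (P a) \<le> 2 * vnorm g / \<delta>" if "cmod a \<le> \<rho>" for a
    using low'[OF P[OF that] that] eq[OF that] \<delta> by (simp add: vnorm_uminus field_simps)
  \<comment> \<open>The contraction factor combines \<open>2 / \<delta>\<close> from the shifted
    lower bound, \<open>2 * vnorm g / \<delta>\<close> from the size of \<open>P b\<close>, and
    \<open>vnorm h\<close> from Cauchy-Schwarz.\<close>
  define \<kappa> where "\<kappa> = 4 * (vnorm g * vnorm h) / \<delta>\<^sup>2"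
  have \<kappa>: "0 \<le> \<kappa>" "\<kappa> < 1"
    using \<delta> small by (auto simp: \<kappa>_def field_simps)
  have "\<exists>!a\<in>cball 0 \<rho>. P a \<bullet>c h = a"
  proof (rule Banach_fix[OF _ _ \<kappa>])
    show "(\<lambda>a. P a \<bullet>c h) ` cball 0 \<rho> \<subseteq> cball 0 \<rho>"
    proof safe
      fix a assume "a \<in> cball (0 :: complex) \<rho>"
      then have a: "cmod a \<le> \<rho>" by simp
      have "cmod (P a \<bullet>c h) \<le> vnorm (P a) * vnorm h"
        by (rule cmod_cscalar_prod_le[OF P[OF a] h])
      also have "\<dots> \<le> 2 * vnorm g / \<delta> * vnorm h"
        using Pn[OF a] by (intro mult_right_mono) auto
      finally show "P a \<bullet>c h \<in> cball 0 \<rho>"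
        by (simp add: \<rho>_def)
    qed
    show "dist (P a \<bullet>c h) (P b \<bullet>c h) \<le> \<kappa> * dist a b" if "a \<in> cball 0 \<rho>" "b \<in> cball 0 \<rho>" for a b
    proof -
      have a: "cmod a \<le> \<rho>" and b: "cmod b \<le> \<rho>"
        using that by auto
      let ?d = "P a - P b"
      have d: "?d \<in> carrier_vec M"
        using P[OF a] P[OF b] by simp
      \<comment> \<open>First resolvent identity: subtract the defining equations of
        \<open>P a\<close> and \<open>P b\<close>.\<close>
      have "C *\<^sub>v ?d - a \<cdot>\<^sub>v ?d = (a - b) \<cdot>\<^sub>v P b"
      proof (rule eq_vecI)
        fix i assume "i < dim_vec ((a - b) \<cdot>\<^sub>v P b)"
        then have i: "i < M" using P[OF b] by auto
        have "(C *\<^sub>v ?d) $ i = (C *\<^sub>v P a) $ i - (C *\<^sub>v P b) $ i"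
          using mult_minus_distrib_mat_vec[OF C P[OF a] P[OF b]] C i by simp
        moreover have "(C *\<^sub>v P a) $ i = - g $ i + a * P a $ i"
          using arg_cong[OF eq[OF a], of "\<lambda>v. v $ i"] P[OF a] C g i
          by (simp add: diff_eq_eq del: index_mult_mat_vec)
        moreover have "(C *\<^sub>v P b) $ i = - g $ i + b * P b $ i"
          using arg_cong[OF eq[OF b], of "\<lambda>v. v $ i"] P[OF b] C g i
          by (simp add: diff_eq_eq del: index_mult_mat_vec)
        ultimately show "(C *\<^sub>v ?d - a \<cdot>\<^sub>v ?d) $ i = ((a - b) \<cdot>\<^sub>v P b) $ i"
          using P[OF a] P[OF b] C i
          by (simp add: left_diff_distrib right_diff_distrib del: index_mult_mat_vec)
      qed (use C P[OF a] P[OF b] in auto)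
      then have "\<delta> / 2 * vnorm ?d \<le> cmod (a - b) * vnorm (P b)"
        using low'[OF d a] by (simp add: vnorm_smult)
      also have "\<dots> \<le> cmod (a - b) * (2 * vnorm g / \<delta>)"
        using Pn[OF b] by (intro mult_left_mono) auto
      finally have dn: "vnorm ?d \<le> cmod (a - b) * (4 * vnorm g / \<delta>\<^sup>2)"
        using \<delta> by (simp add: field_simps power2_eq_square)
      have "dist (P a \<bullet>c h) (P b \<bullet>c h) = cmod (?d \<bullet>c h)"
        using cscalar_prod_diff_left[OF P[OF a] P[OF b] h] by (simp add: dist_norm)
      also have "\<dots> \<le> vnorm ?d * vnorm h"
        by (rule cmod_cscalar_prod_le[OF d h])
      also have "\<dots> \<le> cmod (a - b) * (4 * vnorm g / \<delta>\<^sup>2) * vnorm h"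
        using dn by (intro mult_right_mono) auto
      finally show ?thesis
        by (simp add: \<kappa>_def dist_norm mult_ac)
    qed
  qed (use \<rho> in \<open>auto simp: complete_eq_closed\<close>)
  then obtain a where a: "cmod a \<le> \<rho>" "P a \<bullet>c h = a"
    by auto
  show thesis
    by (rule that[of "P a"]) (use P[OF a(1)] eq[OF a(1)] Pn[OF a(1)] a(2) in simp_all)
qed

section \<open>Eigenvectors near a unit vector with small residual\<close>

lemma compression_carrier:
  assumes "orthonormal_split N q Y" "B \<in> carrier_mat N N"
  shows "mat_adjoint Y * B * Y \<in> carrier_mat (N - 1) (N - 1)"
    and "mat_adjoint Y * B * Y - \<eta> \<cdot>\<^sub>m 1\<^sub>m (dim_col Y) \<in> carrier_mat (N - 1) (N - 1)"
proof -
  note Y = orthonormal_splitD(2)[OF assms(1)]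
  show *: "mat_adjoint Y * B * Y \<in> carrier_mat (N - 1) (N - 1)"
    using Y assms(2) by (intro mult_carrier_mat[of _ _ N]) auto
  show "mat_adjoint Y * B * Y - \<eta> \<cdot>\<^sub>m 1\<^sub>m (dim_col Y) \<in> carrier_mat (N - 1) (N - 1)"
    using Y by (intro minus_carrier_mat) auto
qed

lemma compression_mult_vec:
  assumes "orthonormal_split N q Y" "B \<in> carrier_mat N N" "z \<in> carrier_vec (N - 1)"
  shows "(mat_adjoint Y * B * Y) *\<^sub>v z = mat_adjoint Y *\<^sub>v (B *\<^sub>v (Y *\<^sub>v z))"
proof -
  note Y = orthonormal_splitD(2)[OF assms(1)]
  have "(mat_adjoint Y * B * Y) *\<^sub>v z = (mat_adjoint Y * B) *\<^sub>v (Y *\<^sub>v z)"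
    using Y assms by (intro assoc_mult_mat_vec) auto
  also have "\<dots> = mat_adjoint Y *\<^sub>v (B *\<^sub>v (Y *\<^sub>v z))"
    using Y assms by (intro assoc_mult_mat_vec[of _ _ N _ N]) auto
  finally show ?thesis .
qed

text \<open>In the basis \<open>[q, Y]\<close>, \<open>B\<close> has the diagonal blocks
  \<open>\<eta>\<close> and \<open>C + \<eta> I\<close>, the row \<open>h\<^sup>*\<close> to the
  right of the corner and the column \<open>g\<close> below it. Hence \<open>q + Y p\<close> is an
  eigenvector for \<open>\<eta> + a\<close> iff \<open>a = h\<^sup>* p\<close> and
  \<open>g + C p = a p\<close>. The hypothesis \<open>R\<close> states that \<open>\<eta>\<close> is
  the Rayleigh quotient of \<open>q\<close>.\<close>

lemma nearby_eigenvector: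
  fixes B :: "complex mat"
  assumes B: "B \<in> carrier_mat N N" and s: "orthonormal_split N q Y"
    and R: "(B *\<^sub>v q - \<eta> \<cdot>\<^sub>v q) \<bullet>c q = 0"
    and \<delta>_def: "\<delta> = sigma_min (mat_adjoint Y * B * Y - \<eta> \<cdot>\<^sub>m 1\<^sub>m (dim_col Y))" and \<delta>: "\<delta> > 0"
    and small: "vnorm (B *\<^sub>v q - \<eta> \<cdot>\<^sub>v q) * vnorm (s_vec B \<eta> q) < \<delta>\<^sup>2 / 4"
  obtains p a where "p \<in> carrier_vec (N - 1)" "B *\<^sub>v (q + Y *\<^sub>v p) = (\<eta> + a) \<cdot>\<^sub>v (q + Y *\<^sub>v p)"
    "cmod a \<le> 2 * (vnorm (s_vec B \<eta> q) * vnorm (B *\<^sub>v q - \<eta> \<cdot>\<^sub>v q) / \<delta>)"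
    "vnorm p \<le> 2 * vnorm (B *\<^sub>v q - \<eta> \<cdot>\<^sub>v q) / \<delta>"
proof -
  note d = orthonormal_splitD[OF s]
  note Yc = orthonormal_split_mult_carrier[OF s]
  define C where "C = mat_adjoint Y * B * Y - \<eta> \<cdot>\<^sub>m 1\<^sub>m (dim_col Y)"
  have C: "C \<in> carrier_mat (N - 1) (N - 1)"
    unfolding C_def by (rule compression_carrier[OF s B])
  define res where "res = B *\<^sub>v q - \<eta> \<cdot>\<^sub>v q"
  have res: "res \<in> carrier_vec N"
    using B d(1) by (auto simp: res_def)
  define sv where "sv = s_vec B \<eta> q"
  have sv: "sv \<in> carrier_vec N"
    using B d(1) by (auto simp: sv_def s_vec_def)
  define g where "g = mat_adjoint Y *\<^sub>v res"
  define h where "h = mat_adjoint Y *\<^sub>v sv"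
  have g: "g \<in> carrier_vec (N - 1)" and h: "h \<in> carrier_vec (N - 1)"
    using d(2) by (simp_all add: g_def h_def)
  have ng: "vnorm g \<le> vnorm res" and nh: "vnorm h \<le> vnorm sv"
    using orthonormal_split_vnorm_adjoint_le[OF s] res sv by (simp_all add: g_def h_def)
  have "vnorm g * vnorm h \<le> vnorm res * vnorm sv"
    using ng nh by (intro mult_mono) auto
  then have gh: "vnorm g * vnorm h < \<delta>\<^sup>2 / 4"
    using small by (simp add: res_def sv_def)
  have low: "\<delta> * vnorm x \<le> vnorm (C *\<^sub>v x)" if "x \<in> carrier_vec (N - 1)" for x
    using sigma_min_mult_vnorm_le[OF C _ that] \<delta> by (simp add: \<delta>_def C_def)
  obtain p where p: "p \<in> carrier_vec (N - 1)" and eq: "C *\<^sub>v p - (p \<bullet>c h) \<cdot>\<^sub>v p = - g"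
    and np: "vnorm p \<le> 2 * vnorm g / \<delta>"
    using quadratic_system_solution[OF C g h \<delta> low gh] by blast
  define a where "a = p \<bullet>c h"
  have "2 * vnorm g / \<delta> \<le> 2 * vnorm res / \<delta>"
    using ng \<delta> by (intro divide_right_mono) auto
  then have np': "vnorm p \<le> 2 * vnorm res / \<delta>"
    using np by simp
  have "cmod a \<le> vnorm p * vnorm h"
    unfolding a_def by (rule cmod_cscalar_prod_le[OF p h])
  also have "\<dots> \<le> 2 * vnorm res / \<delta> * vnorm sv"
    using np' nh \<delta> by (intro mult_mono) auto
  finally have na: "cmod a \<le> 2 * (vnorm sv * vnorm res / \<delta>)"
    by (simp add: mult_ac)
  let ?w = "q + Y *\<^sub>v p"
  have w: "?w \<in> carrier_vec N" and Bw: "B *\<^sub>v ?w \<in> carrier_vec N"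
    and Bq: "B *\<^sub>v q \<in> carrier_vec N" and BYp: "B *\<^sub>v (Y *\<^sub>v p) \<in> carrier_vec N"
    using d(1) Yc B by auto
  have Bw_add: "B *\<^sub>v ?w = B *\<^sub>v q + B *\<^sub>v (Y *\<^sub>v p)"
    by (rule mult_add_distrib_mat_vec[OF B d(1) Yc])
  have "(B *\<^sub>v q) \<bullet>c q = \<eta>"
    using R cscalar_prod_diff_left[OF Bq, of "\<eta> \<cdot>\<^sub>v q" q] d(1,4) by (simp add: cscalar_prod_smult_left[of _ N])
  moreover have "(B *\<^sub>v (Y *\<^sub>v p)) \<bullet>c q = a"
  proof -
    \<comment> \<open>The summand \<open>cnj \<eta> \<cdot>\<^sub>v q\<close> is orthogonal to
      \<open>Y p\<close>, so only \<open>sv\<close> contributes to the coordinate along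
      \<open>q\<close>.\<close>
    have "mat_adjoint B *\<^sub>v q = sv + cnj \<eta> \<cdot>\<^sub>v q"
      using B d(1) by (auto simp: sv_def s_vec_def)
    then have "(B *\<^sub>v (Y *\<^sub>v p)) \<bullet>c q = (Y *\<^sub>v p) \<bullet>c (sv + cnj \<eta> \<cdot>\<^sub>v q)"
      using cscalar_prod_mat_adjoint[OF B Yc d(1)] by simp
    also have "\<dots> = (Y *\<^sub>v p) \<bullet>c sv"
      using cscalar_prod_add_right[OF sv _ Yc, of "cnj \<eta> \<cdot>\<^sub>v q"] orthonormal_split_orthogonal(1)[OF s p] d(1) Yc
      by (simp add: cscalar_prod_smult_right[of _ N])
    also have "\<dots> = a"
      unfolding a_def h_def by (rule cscalar_prod_mat_adjoint[OF d(2) p sv])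
    finally show ?thesis .
  qed
  ultimately have c1: "(B *\<^sub>v ?w) \<bullet>c q = \<eta> + a"
    using cscalar_prod_add_left[OF Bq BYp d(1)] by (simp add: Bw_add)
  \<comment> \<open>The coordinates along \<open>Y\<close> are \<open>g + C p + \<eta> p\<close>,
    and the quadratic equation replaces \<open>g + C p\<close> by \<open>a p\<close>.\<close>
  have c2: "mat_adjoint Y *\<^sub>v (B *\<^sub>v ?w) = (\<eta> + a) \<cdot>\<^sub>v p"
  proof (rule eq_vecI)
    fix i assume "i < dim_vec ((\<eta> + a) \<cdot>\<^sub>v p)"
    then have i: "i < N - 1" using p by auto
    have Ya: "mat_adjoint Y \<in> carrier_mat (N - 1) N"
      using d(2) by simp
    have "C *\<^sub>v p = mat_adjoint Y *\<^sub>v (B *\<^sub>v (Y *\<^sub>v p)) - \<eta> \<cdot>\<^sub>v p"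
      using compression_mult_vec[OF s B p] compression_carrier(1)[OF s B] d(2) p
      by (simp add: C_def minus_mult_distrib_mat_vec[of _ "N - 1" "N - 1"] smult_one_mult_vec)
    then have "(mat_adjoint Y *\<^sub>v (B *\<^sub>v (Y *\<^sub>v p))) $ i - \<eta> * p $ i - a * p $ i = - g $ i"
      using arg_cong[OF eq, of "\<lambda>v. v $ i"] p g i by (simp add: a_def del: index_mult_mat_vec)
    note pi = this
    have "B *\<^sub>v q = res + \<eta> \<cdot>\<^sub>v q"
      using B d(1) by (intro eq_vecI) (auto simp: res_def)
    moreover have "\<eta> \<cdot>\<^sub>v 0\<^sub>v (N - 1) = 0\<^sub>v (N - 1)"
      by (intro eq_vecI) auto
    ultimately have "mat_adjoint Y *\<^sub>v (B *\<^sub>v q) = g"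
      using mult_add_distrib_mat_vec[OF Ya res, of "\<eta> \<cdot>\<^sub>v q"] mult_mat_vec[OF Ya d(1)] d(1,6) g
      by (simp add: g_def)
    with pi show "(mat_adjoint Y *\<^sub>v (B *\<^sub>v ?w)) $ i = ((\<eta> + a) \<cdot>\<^sub>v p) $ i"
      using mult_add_distrib_mat_vec[OF Ya Bq BYp] d(2) p i
      by (simp add: Bw_add algebra_simps del: index_mult_mat_vec)
  qed (use d(2) p in auto)
  have "B *\<^sub>v ?w = (\<eta> + a) \<cdot>\<^sub>v ?w"
    using d(7)[OF Bw] mult_mat_vec[OF d(2) p, of "\<eta> + a"] d(1) Yc
    by (simp add: c1 c2 smult_add_distrib_vec[of _ N])
  then show thesis
    using that p na np' by (simp add: res_def sv_def)
qed

text \<open>Conjugation by \<open>[q, Y]\<close> makes \<open>B\<close> block triangular with corner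
  \<open>\<theta>\<close>. As \<open>\<theta>\<close> is a simple root, it is no eigenvalue of the
  lower block, which leaves no room for a component of \<open>w\<close> along
  \<open>Y\<close>.\<close>

lemma simple_eigenvector_unique:
  fixes B :: "complex mat"
  assumes B: "B \<in> carrier_mat N N" and simple: "simple_eigenvalue B \<theta>"
    and q: "q \<in> carrier_vec N" "vnorm q = 1" "B *\<^sub>v q = \<theta> \<cdot>\<^sub>v q"
    and w: "w \<in> carrier_vec N" "B *\<^sub>v w = \<theta> \<cdot>\<^sub>v w"
  shows "w = (w \<bullet>c q) \<cdot>\<^sub>v q"
proof -
  have "N \<noteq> 0"
    using q by (intro notI) (simp add: vnorm_def)
  then obtain M where N: "N = Suc M"
    by (cases N) auto
  define Y where "Y = unitary_completion q"
  note uc = unitary_completion_unitary[OF q(1,2), folded Y_def]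
  note d = orthonormal_splitD[OF uc(3)]
  have Y: "Y \<in> carrier_mat N M" using d(2) by (simp add: N)
  define Q where "Q = mat_of_cols N (q # cols Y)"
  have Q: "Q \<in> carrier_mat N N"
    using Y by (auto simp: Q_def N)
  have Qa: "mat_adjoint Q \<in> carrier_mat N N"
    using Q by simp
  have QQ: "mat_adjoint Q * Q = 1\<^sub>m N" "Q * mat_adjoint Q = 1\<^sub>m N"
    using uc(2) Q by (auto simp: unitary_mat_def inverts_mat_def Q_def[symmetric])
  have c0: "col Q 0 = q" and cS: "\<And>j. j < M \<Longrightarrow> col Q (Suc j) = col Y j"
    using q Y by (auto simp: Q_def N)
  have BQ: "B * Q \<in> carrier_mat N N" and BY: "B * Y \<in> carrier_mat N M"
    using B Q Y by auto
  define A3 where "A3 = mat_adjoint Y * B * Y"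
  have A3: "A3 \<in> carrier_mat M M"
    using compression_carrier(1)[OF uc(3) B] by (simp add: A3_def N)
  have A3': "A3 = mat_adjoint Y * (B * Y)"
    unfolding A3_def using B Y by (intro assoc_mult_mat[of _ M N _ N _ M]) auto
  define A' where "A' = mat_adjoint Q * (B * Q)"
  define A2 where "A2 = mat 1 M (\<lambda>(i, j). A' $$ (0, Suc j))"
  have A': "A' \<in> carrier_mat N N"
    using Qa BQ by (simp add: A'_def)
  have idx: "A' $$ (i, j) = (B *\<^sub>v col Q j) \<bullet>c col Q i" if "i < N" "j < N" for i j
    unfolding A'_def index_mat_adjoint_mult[OF Q BQ that] col_mult2[OF B Q that(2)] ..
  \<comment> \<open>The zero block below the corner comes from \<open>B q = \<theta> q\<close> and
    the orthonormality of the columns of \<open>Q\<close>.\<close>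
  have block: "A' = four_block_mat (mat 1 1 (\<lambda>_. \<theta>)) A2 (0\<^sub>m M 1) A3"
  proof (rule eq_matI)
    fix i j assume "i < dim_row (four_block_mat (mat 1 1 (\<lambda>_. \<theta>)) A2 (0\<^sub>m M 1) A3)"
      and "j < dim_col (four_block_mat (mat 1 1 (\<lambda>_. \<theta>)) A2 (0\<^sub>m M 1) A3)"
    then have ij: "i < Suc M" "j < Suc M"
      using A3 by auto
    have first: "A' $$ (i, 0) = (if i = 0 then \<theta> else 0)"
    proof -
      have "A' $$ (i, 0) = \<theta> * (col Q 0 \<bullet>c col Q i)"
        using idx[of i 0] ij q Q by (simp add: N c0 cscalar_prod_smult_left[of _ "Suc M"])
      also have "col Q 0 \<bullet>c col Q i = (if i = 0 then 1 else 0)"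
        using index_mat_adjoint_mult[OF Q Q, of i 0] QQ(1) ij by (simp add: N)
      finally show ?thesis by simp
    qed
    have rest: "A' $$ (Suc i', Suc j') = A3 $$ (i', j')" if "i' < M" "j' < M" for i' j'
      using idx[of "Suc i'" "Suc j'"] that
      unfolding A3' index_mat_adjoint_mult[OF Y BY that] col_mult2[OF B Y that(2)] by (simp add: N cS)
    show "A' $$ (i, j) = four_block_mat (mat 1 1 (\<lambda>_. \<theta>)) A2 (0\<^sub>m M 1) A3 $$ (i, j)"
      using ij first rest A3 by (cases i; cases j) (auto simp: A2_def)
  qed (use A' A3 in \<open>auto simp: N\<close>)
  have "B = (Q * mat_adjoint Q) * B * (Q * mat_adjoint Q)"
    using B by (simp add: QQ)
  also have "\<dots> = Q * A' * mat_adjoint Q"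
    using B Q Qa by (simp add: A'_def assoc_mult_mat[of _ N N _ N _ N] mult_carrier_mat[of _ N N _ N])
  finally have "similar_mat_wit B A' Q (mat_adjoint Q)"
    by (rule similar_mat_witI[OF QQ(2,1) _ B A' Q Qa])
  then have "char_poly B = char_poly A'"
    by (intro char_poly_similar) (auto simp: similar_mat_def)
  also have "\<dots> = char_poly (mat 1 1 (\<lambda>_. \<theta>)) * char_poly A3"
    unfolding block using A3 by (intro char_poly_four_block_zeros_col) (auto simp: A2_def)
  finally have cp: "char_poly B = char_poly (mat 1 1 (\<lambda>_. \<theta>)) * char_poly A3" .
  have cp0: "char_poly B \<noteq> 0"
    using degree_monic_char_poly[OF B] by auto
  have "eigenvalue (mat 1 1 (\<lambda>_. \<theta>)) \<theta>"
    unfolding eigenvalue_def eigenvector_def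
    by (intro exI[of _ "unit_vec 1 0"]) (auto simp: scalar_prod_def vec_eq_iff)
  then have "poly (char_poly (mat 1 1 (\<lambda>_. \<theta>))) \<theta> = 0"
    using eigenvalue_root_char_poly[of "mat 1 1 (\<lambda>_. \<theta>)" 1] by auto
  then have "order \<theta> (char_poly (mat 1 1 (\<lambda>_. \<theta>))) \<noteq> 0"
    using cp0 cp by (auto simp: order_root)
  \<comment> \<open>The corner already contributes order at least 1, and orders of factors add, so
    nothing is left for \<open>A3\<close>.\<close>
  moreover have "order \<theta> (char_poly (mat 1 1 (\<lambda>_. \<theta>))) + order \<theta> (char_poly A3) = 1"
    using simple order_mult[of _ "char_poly A3" \<theta>] cp0 by (simp add: cp simple_eigenvalue_def)
  ultimately have "order \<theta> (char_poly A3) = 0"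
    by simp
  then have no_ev: "\<not> eigenvalue A3 \<theta>"
    using eigenvalue_root_char_poly[OF A3] cp0 cp by (auto simp: order_root)
  define z where "z = mat_adjoint Y *\<^sub>v w"
  have z: "z \<in> carrier_vec M"
    using Y by (simp add: z_def)
  have wd: "w = (w \<bullet>c q) \<cdot>\<^sub>v q + Y *\<^sub>v z"
    unfolding z_def by (rule d(7)[OF w(1)])
  have Ya: "mat_adjoint Y \<in> carrier_mat M N"
    using Y by simp
  \<comment> \<open>Projecting \<open>B w = \<theta> w\<close> onto the columns of \<open>Y\<close>
    removes the part along \<open>q\<close>, so \<open>z\<close> satisfies the eigenvector equation
    of \<open>A3\<close> and must vanish.\<close>
  have "\<theta> \<cdot>\<^sub>v z = mat_adjoint Y *\<^sub>v (B *\<^sub>v w)"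
    using mult_mat_vec[OF Ya w(1)] by (simp add: z_def w(2))
  also have "B *\<^sub>v w = (w \<bullet>c q) \<cdot>\<^sub>v (\<theta> \<cdot>\<^sub>v q) + B *\<^sub>v (Y *\<^sub>v z)"
    using mult_add_distrib_mat_vec[OF B _ orthonormal_split_mult_carrier[OF uc(3), of z], of "(w \<bullet>c q) \<cdot>\<^sub>v q"]
      mult_mat_vec[OF B q(1)] q wd by simp
  also have "mat_adjoint Y *\<^sub>v \<dots> = mat_adjoint Y *\<^sub>v ((w \<bullet>c q) \<cdot>\<^sub>v (\<theta> \<cdot>\<^sub>v q)) + mat_adjoint Y *\<^sub>v (B *\<^sub>v (Y *\<^sub>v z))"
    using q B orthonormal_split_mult_carrier[OF uc(3), of z]
    by (intro mult_add_distrib_mat_vec[OF Ya]) auto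
  also have "mat_adjoint Y *\<^sub>v ((w \<bullet>c q) \<cdot>\<^sub>v (\<theta> \<cdot>\<^sub>v q)) = 0\<^sub>v M"
    using mult_mat_vec[OF Ya q(1)] d(6) by (auto simp: smult_smult_assoc N)
  also have "mat_adjoint Y *\<^sub>v (B *\<^sub>v (Y *\<^sub>v z)) = A3 *\<^sub>v z"
    using compression_mult_vec[OF uc(3) B, of z] z by (simp add: A3_def N)
  finally have "A3 *\<^sub>v z = \<theta> \<cdot>\<^sub>v z"
    using A3 z by simp
  then have "z = 0\<^sub>v M"
    using no_ev A3 z by (auto simp: eigenvalue_def eigenvector_def)
  moreover have "Y *\<^sub>v 0\<^sub>v M = 0\<^sub>v N"
    using Y by auto
  ultimately show ?thesis
    using wd q(1) w(1) by simp
qed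

subsection \<open>The bidiagonalization matrices\<close>

text \<open>Since \<open>mat_fun\<close> is a choice, even its dimensions rest on the existence of a
  Jordan decomposition, which holds because characteristic polynomials split over the complex
  numbers.\<close>

lemma mat_fun_carrier:
  assumes A: "A \<in> carrier_mat n n"
  shows "mat_fun f A \<in> carrier_mat n n"
proof -
  obtain as where "char_poly A = (\<Prod>a\<leftarrow>as. [:- a, 1:])"
    using char_poly_factorized[OF A] by blast
  then obtain n_as where "jordan_nf A n_as"
    using jordan_nf_exists[OF A] by blast
  then obtain P Q where *: "0 \<notin> fst ` set n_as" "similar_mat_wit A (jordan_matrix n_as) P Q"
    by (auto simp: jordan_nf_def similar_mat_def)
  define R where "R B \<longleftrightarrow> (\<exists>n_as P Q. 0 \<notin> fst ` set n_as \<and> similar_mat_wit A (jordan_matrix n_as) P Q \<and>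
      B = P * diag_block_mat (map (\<lambda>(k, a). fun_jordan_block f k a) n_as) * Q)" for B
  have "R (P * diag_block_mat (map (\<lambda>(k, a). fun_jordan_block f k a) n_as) * Q)"
    unfolding R_def by (intro exI conjI) (rule * refl)+
  then have "R (SOME B. R B)"
    by (rule someI)
  also have "(SOME B. R B) = mat_fun f A"
    unfolding R_def mat_fun_def ..
  finally obtain n_as P Q where sim: "similar_mat_wit A (jordan_matrix n_as) P Q"
    and B: "mat_fun f A = P * diag_block_mat (map (\<lambda>(k, a). fun_jordan_block f k a) n_as) * Q"
    unfolding R_def by (elim exE conjE) (rule that)
  show ?thesis
    unfolding B using similar_mat_witD2(6,7)[OF A sim] by (intro carrier_matI) auto
qed

lemma lead_mat_carrier [simp]: "lead_mat t k \<in> carrier_mat k k"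
  by (simp add: lead_mat_def)

lemma B_mat_carrier: "B_mat \<mu> t k \<in> carrier_mat (2 * k) (2 * k)"
  unfolding B_mat_def mult_2 by (intro four_block_carrier_mat) auto

lemma seq_mat_carrier [simp]: "seq_mat n u k \<in> carrier_mat n k"
  by (rule carrier_matI) (simp_all add: seq_mat_def del: upt_Suc)

lemma index_seq_mat:
  "i < n \<Longrightarrow> j < k \<Longrightarrow> seq_mat n u k $$ (i, j) = u (Suc j) $ i"
  by (simp add: seq_mat_def mat_of_cols_index del: upt_Suc)

lemma B_mat_mult_append:
  assumes "x \<in> carrier_vec k" "y \<in> carrier_vec k"
  shows "B_mat \<mu> t k *\<^sub>v (x @\<^sub>v y) = (lead_mat \<mu> k *\<^sub>v y) @\<^sub>v (lead_mat t k *\<^sub>v x)"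
proof -
  have "B_mat \<mu> t k *\<^sub>v (x @\<^sub>v y) =
      (0\<^sub>m k k *\<^sub>v x + lead_mat \<mu> k *\<^sub>v y) @\<^sub>v (lead_mat t k *\<^sub>v x + 0\<^sub>m k k *\<^sub>v y)"
    unfolding B_mat_def using assms by (intro four_block_mat_mult_vec) auto
  moreover have "0\<^sub>m k k *\<^sub>v x = 0\<^sub>v k" "0\<^sub>m k k *\<^sub>v y = 0\<^sub>v k"
    using assms by auto
  moreover have "lead_mat \<mu> k *\<^sub>v y \<in> carrier_vec k" "lead_mat t k *\<^sub>v x \<in> carrier_vec k"
    using assms by (auto intro: mult_mat_vec_carrier[of _ k k])
  ultimately show ?thesis
    by simp
qed

lemma B_mat_eigenvectorD:
  assumes "eigenvector (B_mat \<mu> t k) q \<theta>"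
  shows "q \<in> carrier_vec (2 * k)" "q \<noteq> 0\<^sub>v (2 * k)" "B_mat \<mu> t k *\<^sub>v q = \<theta> \<cdot>\<^sub>v q"
    and "vec_first q k @\<^sub>v vec_last q k = q"
    and "lead_mat \<mu> k *\<^sub>v vec_last q k = \<theta> \<cdot>\<^sub>v vec_first q k"
    and "lead_mat t k *\<^sub>v vec_first q k = \<theta> \<cdot>\<^sub>v vec_last q k"
proof -
  show q: "q \<in> carrier_vec (2 * k)" "q \<noteq> 0\<^sub>v (2 * k)" and Bq: "B_mat \<mu> t k *\<^sub>v q = \<theta> \<cdot>\<^sub>v q"
    using assms B_mat_carrier[of \<mu> t k] by (auto simp: eigenvector_def)
  show d: "vec_first q k @\<^sub>v vec_last q k = q"
    using q(1) by (simp add: mult_2)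
  let ?x = "vec_first q k" and ?y = "vec_last q k"
  have c: "?x \<in> carrier_vec k" "?y \<in> carrier_vec k"
    by auto
  have "(lead_mat \<mu> k *\<^sub>v ?y) @\<^sub>v (lead_mat t k *\<^sub>v ?x) = \<theta> \<cdot>\<^sub>v (?x @\<^sub>v ?y)"
    using Bq d B_mat_mult_append[OF c, of \<mu> t] by simp
  also have "\<dots> = (\<theta> \<cdot>\<^sub>v ?x) @\<^sub>v (\<theta> \<cdot>\<^sub>v ?y)"
    by (intro eq_vecI) auto
  finally have "lead_mat \<mu> k *\<^sub>v ?y = \<theta> \<cdot>\<^sub>v ?x \<and> lead_mat t k *\<^sub>v ?x = \<theta> \<cdot>\<^sub>v ?y"
    by (subst append_vec_eq[symmetric, of _ k]) (auto intro: mult_mat_vec_carrier[of _ k k])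
  then show "lead_mat \<mu> k *\<^sub>v ?y = \<theta> \<cdot>\<^sub>v ?x" "lead_mat t k *\<^sub>v ?x = \<theta> \<cdot>\<^sub>v ?y"
    by auto
qed

section \<open>Zero-padded eigenvectors of leading blocks\<close>

definition zero_pad :: "nat \<Rightarrow> complex vec \<Rightarrow> complex vec" where
  "zero_pad m x = vec m (\<lambda>i. if i < dim_vec x then x $ i else 0)"

lemma zero_pad_carrier [simp]: "zero_pad m x \<in> carrier_vec m"
  by (simp add: zero_pad_def)

lemma q_tilde_eq:
  assumes "l \<le> m"
  shows "q_tilde m l p = zero_pad m (vec_first p l) @\<^sub>v zero_pad m (vec_last p l)"
  using assms by (intro eq_vecI) (auto simp: q_tilde_def zero_pad_def)

lemma sum_lessThan_zero_pad:
  assumes "l \<le> m" "x \<in> carrier_vec l"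
  shows "(\<Sum>j<m. c j * zero_pad m x $ j) = (\<Sum>j<l. c j * x $ j)"
  using assms by (intro sum.mono_neutral_cong_right) (auto simp: zero_pad_def)

lemma vnorm_zero_pad:
  assumes "l \<le> m" "x \<in> carrier_vec l"
  shows "vnorm (zero_pad m x) = vnorm x"
proof -
  have "(vnorm (zero_pad m x))\<^sup>2 = (vnorm x)\<^sup>2"
    unfolding vnorm_power2[OF zero_pad_carrier] vnorm_power2[OF assms(2)]
    using assms by (intro sum.mono_neutral_cong_right) (auto simp: zero_pad_def)
  then show ?thesis
    by (simp only: power2_eq_iff_nonneg vnorm_nonneg)
qed

lemma vnorm_q_tilde:
  assumes "l \<le> m" "p \<in> carrier_vec (2 * l)"
  shows "vnorm (q_tilde m l p) = vnorm p"
proof -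
  have "vec_first p l @\<^sub>v vec_last p l = p"
    using assms(2) by (simp add: mult_2)
  then have "(vnorm (q_tilde m l p))\<^sup>2 = (vnorm p)\<^sup>2"
    using vnorm_append_power2[of "vec_first p l" "vec_last p l"] assms
    by (simp add: q_tilde_eq vnorm_append_power2 vnorm_zero_pad)
  then show ?thesis
    by (simp only: power2_eq_iff_nonneg vnorm_nonneg)
qed

lemma q_tilde_carrier:
  assumes "l \<le> m"
  shows "q_tilde m l p \<in> carrier_vec (2 * m)"
  unfolding q_tilde_eq[OF assms] mult_2 by (intro append_carrier_vec) auto

text \<open>For \<open>l = k - 1\<close>, the positions \<open>l\<close> and \<open>m + l\<close>,
  counted from 0, are those of the \<open>k\<close>-th components of the two halves.\<close>

lemma q_tilde_index_eq_0:
  assumes "l < m"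
  shows "q_tilde m l p $ l = 0" "q_tilde m l p $ (m + l) = 0"
  using assms by (auto simp: q_tilde_eq zero_pad_def)

text \<open>The first \<open>l\<close> columns of a triangular matrix vanish below row
  \<open>l\<close>; those of a Hessenberg matrix have there only the entry
  \<open>t (l + 1) l\<close>. So padding spoils the eigenvector equation in a single entry, which
  lies in the second half.\<close>

lemma B_mat_mult_q_tilde:
  assumes l: "1 \<le> l" "l < m"
    and ut: "upper_triangular (lead_mat \<mu> m)" and uh: "upper_hessenberg (lead_mat t m)"
    and ev: "eigenvector (B_mat \<mu> t l) p \<eta>"
  shows "B_mat \<mu> t m *\<^sub>v q_tilde m l p =
    \<eta> \<cdot>\<^sub>v q_tilde m l p + (t (l + 1) l * p $ (l - 1)) \<cdot>\<^sub>v unit_vec (2 * m) (m + l)"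
proof -
  note p = B_mat_eigenvectorD[OF ev]
  define x where "x = vec_first p l"
  define y where "y = vec_last p l"
  have x: "x \<in> carrier_vec l" and y: "y \<in> carrier_vec l"
    by (auto simp: x_def y_def)
  have Mz: "\<mu> (Suc i) (Suc j) = 0" if "i < m" "j < i" for i j
    using ut that by (auto simp: upper_triangular_def lead_mat_def)
  have Tz: "t (Suc i) (Suc j) = 0" if "i < m" "j + 1 < i" for i j
    using uh that by (auto simp: upper_hessenberg_def lead_mat_def)
  have mult: "(lead_mat c k *\<^sub>v z) $ i = (\<Sum>j<k. c (Suc i) (Suc j) * z $ j)"
    if "z \<in> carrier_vec k" "i < k" for c k z i
    using mult_mat_vec_sum[OF lead_mat_carrier that] that by (simp add: lead_mat_def del: index_mult_mat_vec)
  have pad: "(lead_mat c m *\<^sub>v zero_pad m z) $ i = (\<Sum>j<l. c (Suc i) (Suc j) * z $ j)"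
    if "z \<in> carrier_vec l" "i < m" for c z i
    using mult[OF zero_pad_carrier that(2)] sum_lessThan_zero_pad[OF _ that(1)] l by simp
  have M: "lead_mat \<mu> m *\<^sub>v zero_pad m y = \<eta> \<cdot>\<^sub>v zero_pad m x"
  proof (rule eq_vecI)
    fix i assume "i < dim_vec (\<eta> \<cdot>\<^sub>v zero_pad m x)"
    then have i: "i < m" by (simp add: zero_pad_def)
    show "(lead_mat \<mu> m *\<^sub>v zero_pad m y) $ i = (\<eta> \<cdot>\<^sub>v zero_pad m x) $ i"
    proof (cases "i < l")
      case True
      have "(lead_mat \<mu> l *\<^sub>v y) $ i = \<eta> * x $ i"
        using p(5) True x by (simp add: x_def y_def del: index_mult_mat_vec)
      then show ?thesis
        using pad[OF y i] mult[OF y True] i True x by (simp add: zero_pad_def del: index_mult_mat_vec)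
    next
      case False
      then have "(\<Sum>j<l. \<mu> (Suc i) (Suc j) * y $ j) = 0"
        using Mz[OF i] by (intro sum.neutral) auto
      then show ?thesis
        using pad[OF y i] i False x by (simp add: zero_pad_def del: index_mult_mat_vec)
    qed
  qed (simp add: zero_pad_def lead_mat_def)
  have T: "(lead_mat t m *\<^sub>v zero_pad m x) $ i =
      \<eta> * zero_pad m y $ i + (if i = l then t (l + 1) l * p $ (l - 1) else 0)" if i: "i < m" for i
  proof (cases "i < l")
    case True
    have "(lead_mat t l *\<^sub>v x) $ i = \<eta> * y $ i"
      using p(6) True y by (simp add: x_def y_def del: index_mult_mat_vec)
    then show ?thesis
      using pad[OF x i] mult[OF x True] i True y by (simp add: zero_pad_def del: index_mult_mat_vec)
  next
    case False
    \<comment> \<open>In a row \<open>i \<ge> l\<close> only the last of the first \<open>l\<close>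
      columns can be nonzero, and that only when \<open>i = l\<close>.\<close>
    have "(\<Sum>j<l. t (Suc i) (Suc j) * x $ j) = (\<Sum>j<l. if j = l - 1 then t (Suc i) (Suc j) * x $ j else 0)"
      using Tz[OF i] False by (intro sum.cong) auto
    also have "\<dots> = t (Suc i) l * x $ (l - 1)"
      using l by simp
    also have "\<dots> = (if i = l then t (l + 1) l * p $ (l - 1) else 0)"
      using Tz[OF i, of "l - 1"] False l by (auto simp: x_def vec_first_def)
    finally show ?thesis
      using pad[OF x i] i False y by (simp add: zero_pad_def del: index_mult_mat_vec)
  qed
  have B: "B_mat \<mu> t m *\<^sub>v q_tilde m l p = (\<eta> \<cdot>\<^sub>v zero_pad m x) @\<^sub>v (lead_mat t m *\<^sub>v zero_pad m x)"
    using B_mat_mult_append[of "zero_pad m x" m "zero_pad m y" \<mu> t] l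
    by (simp add: q_tilde_eq x_def[symmetric] y_def[symmetric] M)
  have qt: "q_tilde m l p = zero_pad m x @\<^sub>v zero_pad m y"
    using l by (simp add: q_tilde_eq x_def y_def)
  have dims: "dim_vec (zero_pad m x) = m" "dim_vec (zero_pad m y) = m" "dim_row (lead_mat t m) = m"
    by (simp_all add: zero_pad_def lead_mat_def)
  show ?thesis
    unfolding B unfolding qt
  proof (rule eq_vecI)
    fix i assume "i < dim_vec (\<eta> \<cdot>\<^sub>v (zero_pad m x @\<^sub>v zero_pad m y) +
        (t (l + 1) l * p $ (l - 1)) \<cdot>\<^sub>v unit_vec (2 * m) (m + l))"
    then have i: "i < 2 * m" by simp
    show "((\<eta> \<cdot>\<^sub>v zero_pad m x) @\<^sub>v (lead_mat t m *\<^sub>v zero_pad m x)) $ i =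
      (\<eta> \<cdot>\<^sub>v (zero_pad m x @\<^sub>v zero_pad m y) + (t (l + 1) l * p $ (l - 1)) \<cdot>\<^sub>v unit_vec (2 * m) (m + l)) $ i"
    proof (cases "i < m")
      case True
      then show ?thesis
        using l by (simp add: dims)
    next
      case False
      then have "i - m < m" "i - m = l \<longleftrightarrow> i = m + l"
        using i by auto
      then show ?thesis
        using T[of "i - m"] False i l by (simp add: dims del: index_mult_mat_vec)
    qed
  qed (simp add: dims)
qed

section \<open>The size of the residual and the resulting bound on components\<close>

lemma vnorm_unit_vec:
  assumes "i < n"
  shows "vnorm (unit_vec n i) = 1"
proof -
  have "unit_vec n i \<bullet>c unit_vec n i = (1 :: complex)"
    using assms by (subst scalar_prod_left_unit[of _ n]) auto
  then show ?thesis
    using vnorm_eq_1_iff[of "unit_vec n i" n] by simp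
qed

lemma vnorm_orthonormal_col:
  assumes "orthonormal_cols (seq_mat n v k)" "j < k" "v (Suc j) \<in> carrier_vec n"
  shows "vnorm (v (Suc j)) = 1"
proof -
  have "col (seq_mat n v k) j = v (Suc j)"
    using assms(2,3) by (simp add: seq_mat_def del: upt_Suc)
  then have "(mat_adjoint (seq_mat n v k) * seq_mat n v k) $$ (j, j) = v (Suc j) \<bullet>c v (Suc j)"
    using index_mat_adjoint_mult[OF seq_mat_carrier seq_mat_carrier assms(2,2)] by simp
  then show ?thesis
    using assms vnorm_eq_1_iff[OF assms(3)] seq_mat_carrier[of n v k]
    by (simp add: orthonormal_cols_def del: index_mult_mat)
qed

text \<open>The vector \<open>[0; v\<^sub>l\<^sub>+\<^sub>1]\<close> has norm 1, and position
  \<open>l - 1\<close> of \<open>p\<close> is the last entry of its first half. Thus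
  \<open>r_vec\<close> has the same norm as the residual of the padded vector, although the two live
  in different spaces.\<close>

lemma vnorm_r_vec:
  assumes "1 \<le> l" "p \<in> carrier_vec (2 * l)" "vnorm (v (l + 1)) = 1"
  shows "vnorm (r_vec n v t l p) = cmod (t (l + 1) l * p $ (l - 1))"
proof -
  have "(vnorm (0\<^sub>v n @\<^sub>v v (l + 1)))\<^sup>2 = 1\<^sup>2"
    using assms(3) vnorm_eq_0_iff[of "0\<^sub>v n" n] by (simp add: vnorm_append_power2)
  then have "vnorm (0\<^sub>v n @\<^sub>v v (l + 1)) = 1"
    by (simp only: power2_eq_iff_nonneg vnorm_nonneg zero_le_one)
  then show ?thesis
    using assms scalar_prod_left_unit[OF assms(2), of "l - 1"] by (simp add: r_vec_def vnorm_smult)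
qed

lemma sum_two_le_vnorm_power2:
  assumes "w \<in> carrier_vec N" "i < N" "j < N" "i \<noteq> j"
  shows "(cmod (w $ i))\<^sup>2 + (cmod (w $ j))\<^sup>2 \<le> (vnorm w)\<^sup>2"
proof -
  have "(\<Sum>k\<in>{i, j}. (cmod (w $ k))\<^sup>2) \<le> (\<Sum>k<N. (cmod (w $ k))\<^sup>2)"
    using assms by (intro sum_mono2) auto
  then show ?thesis
    using assms by (simp add: vnorm_power2)
qed

text \<open>This justifies the relaxation: the errors of step \<open>k = l + 1\<close> are weighted
  by exactly these two components of \<open>q\<close>. The padded vector vanishes there, so they
  come only from the correction \<open>Y z\<close>.\<close>

lemma admissible_component_bound:
  assumes adm: "admissible n m v \<mu> t \<theta> l \<eta> p" and l: "1 \<le> l" "l < m"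
    and ut: "upper_triangular (lead_mat \<mu> m)" and uh: "upper_hessenberg (lead_mat t m)"
    and v: "vnorm (v (l + 1)) = 1"
    and q: "eigenvector (B_mat \<mu> t m) q \<theta>" "vnorm q = 1" and simple: "simple_eigenvalue (B_mat \<mu> t m) \<theta>"
  shows "(cmod (q $ l))\<^sup>2 + (cmod (q $ (m + l)))\<^sup>2 \<le>
    (2 * vnorm (r_vec n v t l p) / delta (B_mat \<mu> t m) \<eta> (q_tilde m l p))\<^sup>2"
proof -
  define B where "B = B_mat \<mu> t m"
  define qt where "qt = q_tilde m l p"
  define \<delta> where "\<delta> = delta B \<eta> qt"
  define s where "s = vnorm (s_vec B \<eta> qt)"
  define r where "r = vnorm (r_vec n v t l p)"
  have ev: "eigenvector (B_mat \<mu> t l) p \<eta>" and np: "vnorm p = 1" and \<delta>: "\<delta> > 0"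
    and rs: "ereal r < ereal (\<delta>\<^sup>2) / ereal (4 * s)"
    and gap: "\<And>\<theta>'. eigenvalue B \<theta>' \<Longrightarrow> \<theta>' \<noteq> \<theta> \<Longrightarrow> cmod (\<theta>' - \<eta>) > 2 * (s * r / \<delta>)"
    using adm by (auto simp: admissible_def Let_def B_def qt_def \<delta>_def s_def r_def)
  have B: "B \<in> carrier_mat (2 * m) (2 * m)"
    unfolding B_def by (rule B_mat_carrier)
  note p = B_mat_eigenvectorD(1)[OF ev]
  note qd = B_mat_eigenvectorD(1-3)[OF q(1), folded B_def]
  have qt: "qt \<in> carrier_vec (2 * m)" and nqt: "vnorm qt = 1"
    using q_tilde_carrier vnorm_q_tilde[of l m p] l p np by (auto simp: qt_def)
  define Y where "Y = unitary_completion qt"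
  have sp: "orthonormal_split (2 * m) qt Y"
    unfolding Y_def by (rule unitary_completion_unitary(3)[OF qt nqt])
  define \<tau> where "\<tau> = t (l + 1) l * p $ (l - 1)"
  have "B *\<^sub>v qt = \<eta> \<cdot>\<^sub>v qt + \<tau> \<cdot>\<^sub>v unit_vec (2 * m) (m + l)"
    unfolding B_def qt_def \<tau>_def by (rule B_mat_mult_q_tilde[OF l ut uh ev])
  then have res: "B *\<^sub>v qt - \<eta> \<cdot>\<^sub>v qt = \<tau> \<cdot>\<^sub>v unit_vec (2 * m) (m + l)"
    using qt by (intro eq_vecI) auto
  have r: "vnorm (B *\<^sub>v qt - \<eta> \<cdot>\<^sub>v qt) = r"
    using l vnorm_r_vec[where n = n and t = t and v = v, OF l(1) p v] by (simp add: res vnorm_smult vnorm_unit_vec r_def \<tau>_def)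
  \<comment> \<open>The residual is supported at position \<open>m + l\<close>, where
    \<open>qt\<close> is zero.\<close>
  have orth: "(B *\<^sub>v qt - \<eta> \<cdot>\<^sub>v qt) \<bullet>c qt = 0"
    using qt l q_tilde_index_eq_0(2)[OF l(2), of p, folded qt_def] unfolding res
    by (simp add: cscalar_prod_smult_left[of _ "2 * m"] scalar_prod_left_unit[of _ "2 * m"])
  have \<delta>_eq: "\<delta> = sigma_min (mat_adjoint Y * B * Y - \<eta> \<cdot>\<^sub>m 1\<^sub>m (dim_col Y))"
    by (simp add: \<delta>_def delta_def Y_def Let_def)
  have s0: "0 \<le> s"
    by (simp add: s_def)
  have "r * s < \<delta>\<^sup>2 / 4"
  \<comment> \<open>For \<open>s = 0\<close> the quotient in the admissibility condition is infinite
    and says nothing about \<open>r\<close>, but the product bound is then trivial.\<close>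
  proof (cases "s = 0")
    case True
    then show ?thesis
      using \<delta> by simp
  next
    case False
    then have "r < \<delta>\<^sup>2 / (4 * s)"
      using rs by simp
    then show ?thesis
      using False s0 by (simp add: field_simps)
  qed
  then obtain z a where z: "z \<in> carrier_vec (2 * m - 1)"
    and eig: "B *\<^sub>v (qt + Y *\<^sub>v z) = (\<eta> + a) \<cdot>\<^sub>v (qt + Y *\<^sub>v z)"
    and na: "cmod a \<le> 2 * (s * r / \<delta>)" and nz: "vnorm z \<le> 2 * r / \<delta>"
    using nearby_eigenvector[OF B sp orth \<delta>_eq \<delta>] unfolding r s_def[symmetric] by blast
  let ?w = "qt + Y *\<^sub>v z"
  note Yc = orthonormal_split_mult_carrier[OF sp]
  have w: "?w \<in> carrier_vec (2 * m)"
    using qt Yc by simp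
  have "(vnorm ?w)\<^sup>2 = 1 + (vnorm z)\<^sup>2"
    using orthonormal_split_vnorm[OF sp z, of 1] by simp
  then have w2: "(vnorm ?w)\<^sup>2 \<ge> 1"
    by simp
  then have "?w \<noteq> 0\<^sub>v (2 * m)"
    using vnorm_eq_0_iff[OF w] by fastforce
  then have "eigenvalue B (\<eta> + a)"
    using eig w B by (auto simp: eigenvalue_def eigenvector_def)
  \<comment> \<open>By the gap condition every other eigenvalue of \<open>B\<close> is farther from
    \<open>\<eta>\<close> than the bound on \<open>cmod a\<close> permits.\<close>
  then have "\<eta> + a = \<theta>"
    using gap[of "\<eta> + a"] na by fastforce
  then have "?w = (?w \<bullet>c q) \<cdot>\<^sub>v q"
    using simple_eigenvector_unique[OF B simple[folded B_def] qd(1) q(2) qd(3) w] eig by simp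
  then obtain \<alpha> where \<alpha>: "?w = \<alpha> \<cdot>\<^sub>v q"
    by blast
  \<comment> \<open>The vector \<open>qt + Y z\<close> has norm at least 1 by Pythagoras, so passing
    to the unit vector \<open>q\<close> can only shrink components.\<close>
  have \<alpha>1: "(cmod \<alpha>)\<^sup>2 \<ge> 1"
    using w2 unfolding \<alpha> vnorm_smult q(2) by simp
  have comp: "\<alpha> * q $ i = (Y *\<^sub>v z) $ i" if "i < 2 * m" "qt $ i = 0" for i
    using arg_cong[OF \<alpha>, of "\<lambda>x. x $ i"] that qt orthonormal_splitD(2)[OF sp] qd(1)
    by (simp del: index_mult_mat_vec)
  have "(cmod (q $ l))\<^sup>2 + (cmod (q $ (m + l)))\<^sup>2 \<le>
      (cmod \<alpha>)\<^sup>2 * ((cmod (q $ l))\<^sup>2 + (cmod (q $ (m + l)))\<^sup>2)"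
    using mult_right_mono[OF \<alpha>1, of "(cmod (q $ l))\<^sup>2 + (cmod (q $ (m + l)))\<^sup>2"] by simp
  also have "\<dots> = (cmod (\<alpha> * q $ l))\<^sup>2 + (cmod (\<alpha> * q $ (m + l)))\<^sup>2"
    by (simp add: norm_mult power_mult_distrib distrib_left)
  also have "\<dots> = (cmod ((Y *\<^sub>v z) $ l))\<^sup>2 + (cmod ((Y *\<^sub>v z) $ (m + l)))\<^sup>2"
    using comp[of l] comp[of "m + l"] l q_tilde_index_eq_0[OF l(2), of p] by (simp add: qt_def)
  also have "\<dots> \<le> (vnorm (Y *\<^sub>v z))\<^sup>2"
    using l Yc by (intro sum_two_le_vnorm_power2[of _ "2 * m"]) auto
  also have "\<dots> = (vnorm z)\<^sup>2"
    by (simp add: orthonormal_split_vnorm_mult[OF sp z])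
  also have "\<dots> \<le> (2 * r / \<delta>)\<^sup>2"
    using nz by (intro power_mono) auto
  finally show ?thesis
    by (simp add: r_def \<delta>_def B_def qt_def)
qed

subsection \<open>The residual gap\<close>

lemma L2_set_sum_le:
  fixes f :: "nat \<Rightarrow> 'a \<Rightarrow> real"
  assumes "\<And>i k. 0 \<le> f k i"
  shows "L2_set (\<lambda>i. \<Sum>k<m. f k i) A \<le> (\<Sum>k<m. L2_set (f k) A)"
proof (induction m)
  case 0
  then show ?case
    by (simp add: L2_set_def)
next
  case (Suc m)
  have "L2_set (\<lambda>i. \<Sum>k<Suc m. f k i) A \<le> L2_set (\<lambda>i. \<Sum>k<m. f k i) A + L2_set (f m) A"
    using L2_set_triangle_ineq[of "\<lambda>i. \<Sum>k<m. f k i" "f m" A] by simp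
  then show ?case
    using Suc by simp
qed

lemma vnorm_le_sum:
  fixes c :: "nat \<Rightarrow> complex vec"
  assumes w: "w \<in> carrier_vec N" and c: "\<And>k. k < m \<Longrightarrow> c k \<in> carrier_vec N"
    and eq: "\<And>i. i < N \<Longrightarrow> w $ i = (\<Sum>k<m. c k $ i)"
  shows "vnorm w \<le> (\<Sum>k<m. vnorm (c k))"
proof -
  have "vnorm w \<le> L2_set (\<lambda>i. \<Sum>k<m. cmod (c k $ i)) {..<N}"
    unfolding vnorm_eq_L2_set[OF w] using eq by (intro L2_set_mono) (simp_all add: norm_sum)
  also have "\<dots> \<le> (\<Sum>k<m. L2_set (\<lambda>i. cmod (c k $ i)) {..<N})"
    by (rule L2_set_sum_le[where f = "\<lambda>k i. cmod (c k $ i)"]) simp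
  also have "\<dots> = (\<Sum>k<m. vnorm (c k))"
    using c by (intro sum.cong) (auto simp: vnorm_eq_L2_set[of _ N])
  finally show ?thesis .
qed

text \<open>The \<open>k\<close>-th columns of both blocks are paired before the triangle inequality
  is applied. This keeps \<open>x $ k\<close> and \<open>y $ k\<close> together under one Euclidean
  norm and gives \<open>m\<close> summands instead of \<open>2 * m\<close>.\<close>

lemma vnorm_seq_mat_blocks_le:
  assumes g: "\<And>k. k < m \<Longrightarrow> g1 (Suc k) \<in> carrier_vec n" "\<And>k. k < m \<Longrightarrow> g2 (Suc k) \<in> carrier_vec n"
    and xy: "x \<in> carrier_vec m" "y \<in> carrier_vec m"
  shows "vnorm ((seq_mat n g1 m *\<^sub>v y) @\<^sub>v (seq_mat n g2 m *\<^sub>v x)) \<le>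
    (\<Sum>k<m. vnorm ((y $ k \<cdot>\<^sub>v g1 (Suc k)) @\<^sub>v (x $ k \<cdot>\<^sub>v g2 (Suc k))))"
proof (rule vnorm_le_sum[of _ "n + n"])
  have mult: "(seq_mat n g m *\<^sub>v z) $ i = (\<Sum>k<m. z $ k * g (Suc k) $ i)"
    if "z \<in> carrier_vec m" "i < n" for g z i
    unfolding mult_mat_vec_sum[OF seq_mat_carrier that]
    using that by (intro sum.cong) (simp_all add: index_seq_mat mult.commute)
  have dims: "dim_row (seq_mat n g m) = n" for g
    using carrier_matD(1)[OF seq_mat_carrier[of n g m]] .
  show "(seq_mat n g1 m *\<^sub>v y) @\<^sub>v (seq_mat n g2 m *\<^sub>v x) \<in> carrier_vec (n + n)"
    by (intro append_carrier_vec) (auto simp: dims intro!: carrier_vecI)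
  show "(y $ k \<cdot>\<^sub>v g1 (Suc k)) @\<^sub>v (x $ k \<cdot>\<^sub>v g2 (Suc k)) \<in> carrier_vec (n + n)" if "k < m" for k
    using g that by (intro append_carrier_vec) auto
  fix i assume i: "i < n + n"
  show "((seq_mat n g1 m *\<^sub>v y) @\<^sub>v (seq_mat n g2 m *\<^sub>v x)) $ i =
      (\<Sum>k<m. ((y $ k \<cdot>\<^sub>v g1 (Suc k)) @\<^sub>v (x $ k \<cdot>\<^sub>v g2 (Suc k))) $ i)"
  proof (cases "i < n")
    case True
    have "((seq_mat n g1 m *\<^sub>v y) @\<^sub>v (seq_mat n g2 m *\<^sub>v x)) $ i = (seq_mat n g1 m *\<^sub>v y) $ i"
      using True by (simp add: dims del: index_mult_mat_vec)
    also have "\<dots> = (\<Sum>k<m. y $ k * g1 (Suc k) $ i)"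
      by (rule mult[OF xy(2) True])
    also have "\<dots> = (\<Sum>k<m. ((y $ k \<cdot>\<^sub>v g1 (Suc k)) @\<^sub>v (x $ k \<cdot>\<^sub>v g2 (Suc k))) $ i)"
    proof (rule sum.cong[OF refl])
      fix k assume "k \<in> {..<m}"
      then have "dim_vec (g1 (Suc k)) = n" "dim_vec (g2 (Suc k)) = n"
        using g by auto
      then show "y $ k * g1 (Suc k) $ i = ((y $ k \<cdot>\<^sub>v g1 (Suc k)) @\<^sub>v (x $ k \<cdot>\<^sub>v g2 (Suc k))) $ i"
        using True by simp
    qed
    finally show ?thesis .
  next
    case False
    then have i': "i - n < n"
      using i by simp
    have "((seq_mat n g1 m *\<^sub>v y) @\<^sub>v (seq_mat n g2 m *\<^sub>v x)) $ i = (seq_mat n g2 m *\<^sub>v x) $ (i - n)"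
      using False i by (simp add: dims del: index_mult_mat_vec)
    also have "\<dots> = (\<Sum>k<m. x $ k * g2 (Suc k) $ (i - n))"
      by (rule mult[OF xy(1) i'])
    also have "\<dots> = (\<Sum>k<m. ((y $ k \<cdot>\<^sub>v g1 (Suc k)) @\<^sub>v (x $ k \<cdot>\<^sub>v g2 (Suc k))) $ i)"
    proof (rule sum.cong[OF refl])
      fix k assume "k \<in> {..<m}"
      then have "dim_vec (g1 (Suc k)) = n" "dim_vec (g2 (Suc k)) = n"
        using g by auto
      then show "x $ k * g2 (Suc k) $ (i - n) = ((y $ k \<cdot>\<^sub>v g1 (Suc k)) @\<^sub>v (x $ k \<cdot>\<^sub>v g2 (Suc k))) $ i"
        using False i by simp
    qed
    finally show ?thesis .
  qed
qed

lemma vnorm_weighted_append_le: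
  assumes "vnorm g \<le> K" "vnorm h \<le> K" "(cmod x)\<^sup>2 + (cmod y)\<^sup>2 \<le> \<rho>\<^sup>2" "0 \<le> \<rho>"
  shows "vnorm ((y \<cdot>\<^sub>v g) @\<^sub>v (x \<cdot>\<^sub>v h)) \<le> K * \<rho>"
proof -
  have "0 \<le> K"
    using assms(1) vnorm_nonneg[of g] by linarith
  have "(vnorm ((y \<cdot>\<^sub>v g) @\<^sub>v (x \<cdot>\<^sub>v h)))\<^sup>2 = (cmod y)\<^sup>2 * (vnorm g)\<^sup>2 + (cmod x)\<^sup>2 * (vnorm h)\<^sup>2"
    by (simp add: vnorm_append_power2 vnorm_smult power_mult_distrib)
  also have "\<dots> \<le> (cmod y)\<^sup>2 * K\<^sup>2 + (cmod x)\<^sup>2 * K\<^sup>2"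
    using assms by (intro add_mono mult_left_mono power_mono) auto
  also have "\<dots> = K\<^sup>2 * ((cmod x)\<^sup>2 + (cmod y)\<^sup>2)"
    by (simp add: algebra_simps)
  also have "\<dots> \<le> K\<^sup>2 * \<rho>\<^sup>2"
    using assms(3) by (intro mult_left_mono) auto
  also have "\<dots> = (K * \<rho>)\<^sup>2"
    by (simp add: power_mult_distrib)
  finally show ?thesis
    by (rule power2_le_imp_le) (use \<open>0 \<le> K\<close> assms(4) in simp)
qed

text \<open>Apply the first Lanczos relation to \<open>y\<close> and the second to \<open>x\<close>.
  The eigenvector equation turns \<open>M y\<close> into \<open>\<theta> x\<close> and
  \<open>T x\<close> into \<open>\<theta> y\<close>, the rank-one term is the second half of
  \<open>r_vec\<close>, and the error terms remain with a minus sign.\<close>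

lemma lanczos_residual:
  assumes fA: "fA \<in> carrier_mat n n" and m: "m \<ge> 1"
    and L: "inexact_lanczos n m fA u v \<mu> t g1 g2"
    and ev: "eigenvector (B_mat \<mu> t m) q \<theta>"
  shows "(F_mat n fA *\<^sub>v (W_mat n u v m *\<^sub>v q) - \<theta> \<cdot>\<^sub>v (W_mat n u v m *\<^sub>v q)) - r_vec n v t m q =
    - ((seq_mat n g1 m *\<^sub>v vec_last q m) @\<^sub>v (seq_mat n g2 m *\<^sub>v vec_first q m))"
proof -
  note q = B_mat_eigenvectorD[OF ev]
  define x where "x = vec_first q m"
  define y where "y = vec_last q m"
  have x: "x \<in> carrier_vec m" and y: "y \<in> carrier_vec m"
    by (auto simp: x_def y_def)
  have qxy: "q = x @\<^sub>v y"
    unfolding x_def y_def by (rule q(4)[symmetric])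
  let ?U = "seq_mat n u m" and ?V = "seq_mat n v m" and ?G1 = "seq_mat n g1 m" and ?G2 = "seq_mat n g2 m"
  let ?M = "lead_mat \<mu> m" and ?T = "lead_mat t m"
  let ?E = "mat_of_cols n [v (m + 1)] * mat_of_rows m [unit_vec m (m - 1)]"
  have seqc: "seq_mat n g m *\<^sub>v z \<in> carrier_vec n" for g z
    using carrier_matD(1)[OF seq_mat_carrier[of n g m]] by (intro carrier_vecI) simp
  have fAc: "fA *\<^sub>v z \<in> carrier_vec n" "mat_adjoint fA *\<^sub>v z \<in> carrier_vec n" for z
    using fA by (auto intro!: carrier_vecI)
  have fAa: "mat_adjoint fA \<in> carrier_mat n n"
    using fA by simp
  have "\<forall>k\<in>{1..m + 1}. v k \<in> carrier_vec n"
    and L1: "fA * ?V + ?G1 = ?U * ?M"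
    and L2: "mat_adjoint fA * ?U + ?G2 = ?V * ?T + t (m + 1) m \<cdot>\<^sub>m ?E"
    using L unfolding inexact_lanczos_def by blast+
  then have vc: "v (m + 1) \<in> carrier_vec n"
    by simp
  have W: "W_mat n u v m *\<^sub>v q = (?U *\<^sub>v x) @\<^sub>v (?V *\<^sub>v y)"
  proof -
    have "W_mat n u v m *\<^sub>v q = (?U *\<^sub>v x + 0\<^sub>m n m *\<^sub>v y) @\<^sub>v (0\<^sub>m n m *\<^sub>v x + ?V *\<^sub>v y)"
      unfolding W_mat_def qxy using x y by (intro four_block_mat_mult_vec) auto
    moreover have "0\<^sub>m n m *\<^sub>v x = 0\<^sub>v n" "0\<^sub>m n m *\<^sub>v y = 0\<^sub>v n"
      using x y by auto
    ultimately show ?thesis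
      using seqc[of u x] seqc[of v y] by simp
  qed
  have F: "F_mat n fA *\<^sub>v ((?U *\<^sub>v x) @\<^sub>v (?V *\<^sub>v y)) =
      (fA *\<^sub>v (?V *\<^sub>v y)) @\<^sub>v (mat_adjoint fA *\<^sub>v (?U *\<^sub>v x))"
  proof -
    have "F_mat n fA *\<^sub>v ((?U *\<^sub>v x) @\<^sub>v (?V *\<^sub>v y)) =
        (0\<^sub>m n n *\<^sub>v (?U *\<^sub>v x) + fA *\<^sub>v (?V *\<^sub>v y)) @\<^sub>v (mat_adjoint fA *\<^sub>v (?U *\<^sub>v x) + 0\<^sub>m n n *\<^sub>v (?V *\<^sub>v y))"
      unfolding F_mat_def using fA seqc by (intro four_block_mat_mult_vec) auto
    moreover have "0\<^sub>m n n *\<^sub>v (?U *\<^sub>v x) = 0\<^sub>v n" "0\<^sub>m n n *\<^sub>v (?V *\<^sub>v y) = 0\<^sub>v n"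
      using seqc[of u x] seqc[of v y] by auto
    ultimately show ?thesis
      using fAc by simp
  qed
  have e1: "fA *\<^sub>v (?V *\<^sub>v y) + ?G1 *\<^sub>v y = \<theta> \<cdot>\<^sub>v (?U *\<^sub>v x)"
  proof -
    have "fA *\<^sub>v (?V *\<^sub>v y) + ?G1 *\<^sub>v y = (fA * ?V + ?G1) *\<^sub>v y"
      using add_mult_distrib_mat_vec[of "fA * ?V" n m ?G1 y] assoc_mult_mat_vec[OF fA seq_mat_carrier y]
        mult_carrier_mat[OF fA seq_mat_carrier] y by simp
    also have "\<dots> = ?U *\<^sub>v (?M *\<^sub>v y)"
      unfolding L1 by (rule assoc_mult_mat_vec[OF seq_mat_carrier lead_mat_carrier y])
    also have "?M *\<^sub>v y = \<theta> \<cdot>\<^sub>v x"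
      unfolding x_def y_def by (rule q(5))
    also have "?U *\<^sub>v (\<theta> \<cdot>\<^sub>v x) = \<theta> \<cdot>\<^sub>v (?U *\<^sub>v x)"
      by (rule mult_mat_vec[OF seq_mat_carrier x])
    finally show ?thesis .
  qed
  define c where "c = t (m + 1) m * x $ (m - 1)"
  have e2: "mat_adjoint fA *\<^sub>v (?U *\<^sub>v x) + ?G2 *\<^sub>v x = \<theta> \<cdot>\<^sub>v (?V *\<^sub>v y) + c \<cdot>\<^sub>v v (m + 1)"
  proof -
    have Ec: "t (m + 1) m \<cdot>\<^sub>m ?E \<in> carrier_mat n m"
      by (intro smult_carrier_mat mult_carrier_mat[of _ _ 1]) auto
    have "mat_adjoint fA *\<^sub>v (?U *\<^sub>v x) + ?G2 *\<^sub>v x = (mat_adjoint fA * ?U + ?G2) *\<^sub>v x"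
      using add_mult_distrib_mat_vec[of "mat_adjoint fA * ?U" n m ?G2 x] assoc_mult_mat_vec[OF fAa seq_mat_carrier x]
        mult_carrier_mat[OF fAa seq_mat_carrier] x by simp
    also have "\<dots> = (?V * ?T) *\<^sub>v x + (t (m + 1) m \<cdot>\<^sub>m ?E) *\<^sub>v x"
      unfolding L2 by (rule add_mult_distrib_mat_vec[OF _ Ec x]) (rule mult_carrier_mat[OF seq_mat_carrier lead_mat_carrier])
    also have "(?V * ?T) *\<^sub>v x = ?V *\<^sub>v (?T *\<^sub>v x)"
      by (rule assoc_mult_mat_vec[OF seq_mat_carrier lead_mat_carrier x])
    also have "?T *\<^sub>v x = \<theta> \<cdot>\<^sub>v y"
      unfolding x_def y_def by (rule q(6))
    also have "?V *\<^sub>v (\<theta> \<cdot>\<^sub>v y) = \<theta> \<cdot>\<^sub>v (?V *\<^sub>v y)"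
      by (rule mult_mat_vec[OF seq_mat_carrier y])
    also have "(t (m + 1) m \<cdot>\<^sub>m ?E) *\<^sub>v x = c \<cdot>\<^sub>v v (m + 1)"
    proof (rule eq_vecI)
      fix i assume "i < dim_vec (c \<cdot>\<^sub>v v (m + 1))"
      then have i: "i < n" using vc by simp
      have "((t (m + 1) m \<cdot>\<^sub>m ?E) *\<^sub>v x) $ i = (\<Sum>j<m. (t (m + 1) m \<cdot>\<^sub>m ?E) $$ (i, j) * x $ j)"
        by (rule mult_mat_vec_sum[OF Ec x i])
      \<comment> \<open>The rank-one matrix has \<open>v (m + 1)\<close> as its last column and
        zeros elsewhere.\<close>
      also have "\<dots> = (\<Sum>j<m. if j = m - 1 then t (m + 1) m * v (m + 1) $ i * x $ j else 0)"
        using i m by (intro sum.cong)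
          (auto simp: scalar_prod_def mat_of_cols_index mat_of_rows_index unit_vec_def)
      also have "\<dots> = (c \<cdot>\<^sub>v v (m + 1)) $ i"
        using m i vc by (simp add: c_def)
      finally show "((t (m + 1) m \<cdot>\<^sub>m ?E) *\<^sub>v x) $ i = (c \<cdot>\<^sub>v v (m + 1)) $ i" .
    qed (use vc in auto)
    finally show ?thesis .
  qed
  have "unit_vec (2 * m) (m - 1) \<bullet> q = x $ (m - 1)"
    using m q(1) by (subst scalar_prod_left_unit[of _ "2 * m"]) (auto simp: x_def vec_first_def)
  then have r: "r_vec n v t m q = c \<cdot>\<^sub>v (0\<^sub>v n @\<^sub>v v (m + 1))"
    by (simp add: r_vec_def c_def)
  have dims: "dim_row (seq_mat n g m) = n" "dim_row fA = n" "dim_col fA = n" "dim_vec (v (Suc m)) = n" for g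
    using carrier_matD(1)[OF seq_mat_carrier[of n g m]] fA vc by auto
  show ?thesis
    unfolding W F r x_def[symmetric] y_def[symmetric]
  proof (rule eq_vecI)
    fix i assume "i < dim_vec (- ((?G1 *\<^sub>v y) @\<^sub>v (?G2 *\<^sub>v x)))"
    then have i: "i < n + n" by (simp add: dims)
    show "(((fA *\<^sub>v (?V *\<^sub>v y)) @\<^sub>v (mat_adjoint fA *\<^sub>v (?U *\<^sub>v x))) - \<theta> \<cdot>\<^sub>v ((?U *\<^sub>v x) @\<^sub>v (?V *\<^sub>v y)) -
        c \<cdot>\<^sub>v (0\<^sub>v n @\<^sub>v v (m + 1))) $ i = (- ((?G1 *\<^sub>v y) @\<^sub>v (?G2 *\<^sub>v x))) $ i"
    proof (cases "i < n")
      case True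
      have "(fA *\<^sub>v (?V *\<^sub>v y)) $ i + (?G1 *\<^sub>v y) $ i = \<theta> * (?U *\<^sub>v x) $ i"
        using arg_cong[OF e1, of "\<lambda>z. z $ i"] True by (simp add: dims del: index_mult_mat_vec)
      then have "(fA *\<^sub>v (?V *\<^sub>v y)) $ i = \<theta> * (?U *\<^sub>v x) $ i - (?G1 *\<^sub>v y) $ i"
        by (simp only: eq_diff_eq)
      then show ?thesis
        using True by (simp add: dims del: index_mult_mat_vec)
    next
      case False
      then have i': "i - n < n"
        using i by simp
      have "(mat_adjoint fA *\<^sub>v (?U *\<^sub>v x)) $ (i - n) + (?G2 *\<^sub>v x) $ (i - n) =
          \<theta> * (?V *\<^sub>v y) $ (i - n) + c * v (m + 1) $ (i - n)"
        using arg_cong[OF e2, of "\<lambda>z. z $ (i - n)"] i' by (simp add: dims del: index_mult_mat_vec)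
      then have "(mat_adjoint fA *\<^sub>v (?U *\<^sub>v x)) $ (i - n) =
          \<theta> * (?V *\<^sub>v y) $ (i - n) + c * v (m + 1) $ (i - n) - (?G2 *\<^sub>v x) $ (i - n)"
        by (simp only: eq_diff_eq)
      then show ?thesis
        using False i i' by (simp add: dims del: index_mult_mat_vec)
    qed
  qed (simp add: dims)
qed

theorem theorem6p2:
  fixes n m :: nat
    and A :: "complex mat" and f :: "complex \<Rightarrow> complex"
    and u v g1 g2 :: "nat \<Rightarrow> complex vec"
    and \<mu> t :: "nat \<Rightarrow> nat \<Rightarrow> complex"
    and \<theta> :: complex and q :: "complex vec"
    and \<epsilon> :: real
  assumes "A \<in> carrier_mat n n"
    and "defined_on_spectrum f A"
    and "m \<ge> 1"
    and "inexact_lanczos n m (mat_fun f A) u v \<mu> t g1 g2"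
    and "no_breakdown m \<mu> t"
    and "eigenvector (B_mat \<mu> t m) q \<theta>"
    and "simple_eigenvalue (B_mat \<mu> t m) \<theta>"
    and "vnorm q = 1"
    and "\<epsilon> > 0"
    and "\<forall>k\<in>{1..m}.
           if k > 1 \<and> (\<exists>\<eta> p. admissible n m v \<mu> t \<theta> (k - 1) \<eta> p)
           then \<exists>\<eta> p. admissible n m v \<mu> t \<theta> (k - 1) \<eta> p \<and>
                  ereal (vnorm (g1 k)) \<le> relaxed_bound n m v \<mu> t (k - 1) \<eta> p * ereal \<epsilon> \<and>
                  ereal (vnorm (g2 k)) \<le> relaxed_bound n m v \<mu> t (k - 1) \<eta> p * ereal \<epsilon>
           else vnorm (g1 k) \<le> 1 / real m * \<epsilon> \<and> vnorm (g2 k) \<le> 1 / real m * \<epsilon>"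
  shows "vnorm ((F_mat n (mat_fun f A) *\<^sub>v (W_mat n u v m *\<^sub>v q) - \<theta> \<cdot>\<^sub>v (W_mat n u v m *\<^sub>v q))
                - r_vec n v t m q) \<le> \<epsilon>"
proof -
  note A = assms(1) and m = assms(3) and L = assms(4) and ev = assms(6) and simple = assms(7)
    and nq = assms(8) and \<epsilon> = assms(9) and bounds = assms(10)
  define x where "x = vec_first q m"
  define y where "y = vec_last q m"
  note q = B_mat_eigenvectorD(1)[OF ev]
  have gs: "\<forall>k\<in>{1..m}. u k \<in> carrier_vec n \<and> g1 k \<in> carrier_vec n \<and> g2 k \<in> carrier_vec n"
    and ut: "upper_triangular (lead_mat \<mu> m)" and uh: "upper_hessenberg (lead_mat t m)"
    and ov: "orthonormal_cols (seq_mat n v (m + 1))"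
    and vs: "\<forall>k\<in>{1..m + 1}. v k \<in> carrier_vec n"
    using L unfolding inexact_lanczos_def by blast+
  have g: "g1 (Suc k) \<in> carrier_vec n" "g2 (Suc k) \<in> carrier_vec n" if "k < m" for k
    using gs that by auto
  have vc: "v (Suc k) \<in> carrier_vec n" if "k \<le> m" for k
    using vs that by auto
  have xk: "x $ k = q $ k" "y $ k = q $ (m + k)" if "k < m" for k
    using that q by (auto simp: x_def y_def vec_first_def vec_last_def)
  have "vnorm ((y $ k \<cdot>\<^sub>v g1 (Suc k)) @\<^sub>v (x $ k \<cdot>\<^sub>v g2 (Suc k))) \<le> \<epsilon> / real m" if k: "k < m" for k
  \<comment> \<open>Here \<open>k\<close> counts from 0: it belongs to iteration
    \<open>Suc k\<close>, whose relaxation refers to the leading block of order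
    \<open>k\<close>.\<close>
  proof (cases "k \<ge> 1 \<and> (\<exists>\<eta> p. admissible n m v \<mu> t \<theta> k \<eta> p)")
    case True
    then have "\<exists>\<eta> p. admissible n m v \<mu> t \<theta> k \<eta> p \<and>
        ereal (vnorm (g1 (Suc k))) \<le> relaxed_bound n m v \<mu> t k \<eta> p * ereal \<epsilon> \<and>
        ereal (vnorm (g2 (Suc k))) \<le> relaxed_bound n m v \<mu> t k \<eta> p * ereal \<epsilon>"
      using bspec[OF bounds, of "Suc k"] k by simp
    then obtain \<eta> p where adm: "admissible n m v \<mu> t \<theta> k \<eta> p"
      and b1: "ereal (vnorm (g1 (Suc k))) \<le> relaxed_bound n m v \<mu> t k \<eta> p * ereal \<epsilon>"
      and b2: "ereal (vnorm (g2 (Suc k))) \<le> relaxed_bound n m v \<mu> t k \<eta> p * ereal \<epsilon>"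
      by blast
    define r where "r = vnorm (r_vec n v t k p)"
    define \<delta> where "\<delta> = delta (B_mat \<mu> t m) \<eta> (q_tilde m k p)"
    have \<delta>: "\<delta> > 0"
      using adm by (simp add: admissible_def Let_def \<delta>_def)
    have r0: "0 \<le> r"
      by (simp add: r_def)
    have "vnorm (v (k + 1)) = 1"
      using vnorm_orthonormal_col[OF ov, of k] vc[of k] k by simp
    then have comp: "(cmod (x $ k))\<^sup>2 + (cmod (y $ k))\<^sup>2 \<le> (2 * r / \<delta>)\<^sup>2"
      using admissible_component_bound[OF adm _ k ut uh _ ev nq simple] True xk[OF k]
      by (simp add: r_def \<delta>_def)
    show ?thesis
    \<comment> \<open>For \<open>r = 0\<close> the relaxed bound is infinite and the errors are
      unrestricted, but then both weights \<open>x $ k\<close> and \<open>y $ k\<close>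
      vanish.\<close>
    proof (cases "r = 0")
      case True
      then have "(cmod (x $ k))\<^sup>2 + (cmod (y $ k))\<^sup>2 \<le> 0\<^sup>2"
        using comp by simp
      then have "vnorm ((y $ k \<cdot>\<^sub>v g1 (Suc k)) @\<^sub>v (x $ k \<cdot>\<^sub>v g2 (Suc k))) \<le>
          max (vnorm (g1 (Suc k))) (vnorm (g2 (Suc k))) * 0"
        by (intro vnorm_weighted_append_le) auto
      then show ?thesis
        using \<epsilon> by (simp add: order_trans)
    next
      case False
      \<comment> \<open>The relaxed tolerance as a real number. Its factor
        \<open>\<delta> / (2 * r)\<close> cancels against the component bound
        \<open>2 * r / \<delta>\<close>.\<close>
      define K where "K = \<delta> / (2 * real m * r) * \<epsilon>"
      have "2 * real m * r \<noteq> 0"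
        using False m by simp
      then have "relaxed_bound n m v \<mu> t k \<eta> p * ereal \<epsilon> = ereal K"
        by (simp add: relaxed_bound_def K_def r_def \<delta>_def)
      then have "vnorm ((y $ k \<cdot>\<^sub>v g1 (Suc k)) @\<^sub>v (x $ k \<cdot>\<^sub>v g2 (Suc k))) \<le> K * (2 * r / \<delta>)"
        using b1 b2 comp r0 \<delta> by (intro vnorm_weighted_append_le) auto
      also have "\<dots> = \<epsilon> / real m"
        using False \<delta> m by (simp add: K_def field_simps)
      finally show ?thesis .
    qed
  next
    case False
    then have "\<not> (Suc k > 1 \<and> (\<exists>\<eta> p. admissible n m v \<mu> t \<theta> (Suc k - 1) \<eta> p))"
      by auto
    then have "vnorm (g1 (Suc k)) \<le> \<epsilon> / real m" "vnorm (g2 (Suc k)) \<le> \<epsilon> / real m"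
      using bspec[OF bounds, of "Suc k"] k by (simp_all only: if_False) simp_all
    \<comment> \<open>At the strict tolerance it suffices that \<open>q\<close> is a unit
      vector.\<close>
    moreover have "(cmod (x $ k))\<^sup>2 + (cmod (y $ k))\<^sup>2 \<le> 1\<^sup>2"
      using sum_two_le_vnorm_power2[OF q, of k "m + k"] k nq xk[OF k] by simp
    ultimately have "vnorm ((y $ k \<cdot>\<^sub>v g1 (Suc k)) @\<^sub>v (x $ k \<cdot>\<^sub>v g2 (Suc k))) \<le> \<epsilon> / real m * 1"
      by (intro vnorm_weighted_append_le) auto
    then show ?thesis
      by simp
  qed
  then have "(\<Sum>k<m. vnorm ((y $ k \<cdot>\<^sub>v g1 (Suc k)) @\<^sub>v (x $ k \<cdot>\<^sub>v g2 (Suc k)))) \<le> (\<Sum>k<m. \<epsilon> / real m)"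
    by (intro sum_mono) auto
  also have "\<dots> = \<epsilon>"
    using m by simp
  finally have "vnorm ((seq_mat n g1 m *\<^sub>v y) @\<^sub>v (seq_mat n g2 m *\<^sub>v x)) \<le> \<epsilon>"
    using vnorm_seq_mat_blocks_le[of m g1 n g2 x y, OF g] by (simp add: x_def y_def)
  then show ?thesis
    unfolding lanczos_residual[OF mat_fun_carrier[OF A] m L ev] vnorm_uminus x_def y_def .
qed

end
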